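(* Let $\mathcal{E}$ be the elliptic curve over $\mathbb{Q}$ defined in $\mathbb{P}^2$ with homogeneous coordinates $(a:b:c)$ by $$q(a,b,c) = -c^3 - c^2(a+b) + c(a^2+ab+b^2) + (a^3+a^2b+ab^2+b^3)=0,$$ with identity element $O=(1:-1:0)$. The rank of $\mathcal{E}(\mathbb{Q})$ equals $1$.
   Context: The rank of an elliptic curve over $\mathbb{Q}$ is the rank of its group of rational points as an abelian group. The curve $\mathcal{E}$ is a smooth plane cubic with inflexion point $O=(1:-1:0)$, and $\mathcal{E}(\mathbb{Q})$ carries the usual chord-and-tangent group law with identity $O$. *)

theory Defs
  imports "HOL-Analysis.Cartesian_Space" "HOL-Algebra.FiniteProduct" "HOL-Library.Extended_Nat"
begin

text \<open>
  The projective plane over \<open>\<rat>\<close>: the point with homogeneous coordinates \<open>v \<noteq> 0\<close> is the set of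
  all nonzero multiples of \<open>v\<close>.
\<close>

type_synonym proj_point = "(rat ^ 3) set"

definition proj :: "rat ^ 3 \<Rightarrow> proj_point" where
  "proj v = {k *s v | k. k \<noteq> 0}"

definition cubic :: "rat \<Rightarrow> rat \<Rightarrow> rat \<Rightarrow> rat" where
  "cubic a b c =
     - (c ^ 3) - c ^ 2 * (a + b) + c * (a ^ 2 + a * b + b ^ 2)
     + (a ^ 3 + a ^ 2 * b + a * b ^ 2 + b ^ 3)"

definition cubic_at :: "rat ^ 3 \<Rightarrow> rat" where
  "cubic_at v = cubic (v $ 1) (v $ 2) (v $ 3)"

definition curve_points :: "proj_point set" where
  "curve_points = {proj v | v. v \<noteq> 0 \<and> cubic_at v = 0}"

definition curve_O :: proj_point where
  "curve_O = proj (vector [1, -1, 0])"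

text \<open>
  \<open>line_section P Q R\<close>: some projective line meets the cubic exactly in \<open>P + Q + R\<close>, counted with
  multiplicity. The line is parametrised by \<open>(s : t) \<mapsto> s u + t v\<close>, and the restriction of the
  cubic to it is a nonzero binary cubic form whose roots \<open>(s\<^sub>i : t\<^sub>i)\<close> are the parameters
  of \<open>P\<close>, \<open>Q\<close>, \<open>R\<close>. For \<open>P \<noteq> Q\<close> this is the chord through \<open>P\<close> and \<open>Q\<close>; for \<open>P = Q\<close> the root is
  at least double, so that the line is the tangent at \<open>P\<close> (the curve is smooth).
\<close>

definition line_section :: "proj_point \<Rightarrow> proj_point \<Rightarrow> proj_point \<Rightarrow> bool" where
  "line_section P Q R \<longleftrightarrow>
     (\<exists>u v s1 t1 s2 t2 s3 t3 k.
        u \<noteq> v \<and> vec.independent {u, v} \<and> k \<noteq> 0 \<and>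
        P = proj (s1 *s u + t1 *s v) \<and>
        Q = proj (s2 *s u + t2 *s v) \<and>
        R = proj (s3 *s u + t3 *s v) \<and>
        (\<forall>s t. cubic_at (s *s u + t *s v) =
                 k * (s * t1 - t * s1) * (s * t2 - t * s2) * (s * t3 - t * s3)))"

definition third_point :: "proj_point \<Rightarrow> proj_point \<Rightarrow> proj_point" where
  "third_point P Q = (THE R. R \<in> curve_points \<and> line_section P Q R)"

definition curve_group :: "proj_point monoid" where
  "curve_group =
     \<lparr> carrier = curve_points,
       monoid.mult = (\<lambda>P Q. third_point curve_O (third_point P Q)),
       one = curve_O \<rparr>"

text \<open>
  The rank of an abelian group (written multiplicatively, as in HOL-Algebra) is the supremum of
  the sizes of its finite subsets that are linearly independent over \<open>\<int>\<close>; it is \<open>\<infinity>\<close> if there are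
  arbitrarily large ones.
\<close>

definition int_independent :: "('a, 'b) monoid_scheme \<Rightarrow> 'a set \<Rightarrow> bool" where
  "int_independent G B \<longleftrightarrow>
     (\<forall>n :: 'a \<Rightarrow> int.
        finprod G (\<lambda>x. x [^]\<^bsub>G\<^esub> n x) B = \<one>\<^bsub>G\<^esub> \<longrightarrow> (\<forall>x \<in> B. n x = 0))"

definition abelian_rank :: "('a, 'b) monoid_scheme \<Rightarrow> enat" where
  "abelian_rank G =
     (SUP B \<in> {B. finite B \<and> B \<subseteq> carrier G \<and> int_independent G B}. enat (card B))"

end

(* The cubic has the Weierstrass model Y^2 = X^3 + 5 X^2 - 32 X, whose rational points are in bijection
   with those of the Jacobi quartic y^2 = 153 z^4 - 10 z^2 + 1 via z = X / Y. As 153 is not a square,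
   the quartic has no rational points at infinity and its addition law has no exceptional cases, so
   associativity is a polynomial identity. The chord-tangent construction is transported
   to this law: a line that avoids the 2-torsion point (0, -1) cuts the quartic in a conic
   y = 1 + b z + c z^2.

   The rank is at most 1: with g = (1/3, 4/3) and T = (0, -1), a 2-descent writes every point as
   R + 2 P' with R in {O, T, g, g + T}, and the height of P' does not exceed that of P beyond a
   constant. Iterating, some remainder recurs among finitely many points, whence N P = m g with
   N nonzero. The rank is at least 1: doubling raises the 2-adic valuation of z by one as soon
   as it is positive, so such a point has infinite order. *)

theory Submission
  imports Defs "HOL-Computational_Algebra.Primes"
begin

subsection \<open>The Jacobi quartic\<close>

text \<open>The constants of the quartic are 153 = 5^2 + 4 * 32, the discriminant of X^2 + 5 X - 32,
  and -10 = -2 * 5. For Y \<noteq> 0 its second coordinate is y = (X^2 + 32) / (X^2 + 5 X - 32), and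
  g is the point (X, Y) = (8, 24). As 153 is not a square, T is the only rational point of order 2,
  so doubling is factored through the 2-isogenous curve Y^2 = X (X^2 - 10 X + 153), on which 1 / z^2
  is the X-coordinate of the image of (z, y). A point is a double once its X is a square and one of
  its preimages under the dual isogeny has square X-coordinate too. The first condition costs
  translation by T and g; the second can always be met by the choice of the preimage.

  The transport has its own obstacle: \<open>third_point\<close> is a definite description, so the
  third intersection must be shown unique. The delicate case is a line meeting the cubic three times
  in one point, which off O would be a point of order 3.\<close>

lemma rat_coprime_cases:
  fixes x :: rat
  obtains p q :: int where "q > 0" "coprime p q" "x = of_int p / of_int q"
  by (metis Rat_cases Fract_of_int_quotient)

lemma sq_ne_153: "(x::rat)^2 \<noteq> 153"
proof
  assume x: "x^2 = 153"
  obtain p q :: int where q: "q > 0" and cop: "coprime p q" and pq: "x = of_int p / of_int q"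
    by (rule rat_coprime_cases)
  have "(of_int (p^2) :: rat) = of_int (153 * q^2)"
    using x q by (simp add: pq power_divide field_simps)
  then have e: "p^2 = 153 * q^2" unfolding of_int_eq_iff .
  have pr: "prime (17::int)" by (simp add: prime_int_numeral_eq)
  have "17 dvd p^2" using e by simp
  then have "17 dvd p" using pr prime_dvd_power by blast
  then obtain k where k: "p = 17 * k" ..
  have "17 * k^2 = 9 * q^2" using e k by (simp add: power_mult_distrib)
  then have "17 dvd 9 * q^2" by (metis dvd_triv_left)
  moreover have "\<not> 17 dvd (9::int)" by simp
  ultimately have "17 dvd q" using pr prime_dvd_mult_iff prime_dvd_power by blast
  with \<open>17 dvd p\<close> cop show False
    using coprime_common_divisor by fastforce
qed

lemma one_minus_153_sq: "1 - 153 * (x::rat)^2 \<noteq> 0"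
  using sq_ne_153[of "153 * x"] by (auto simp: power_mult_distrib)

definition jac :: "(rat \<times> rat) set" where
  "jac = {(z, y). y^2 = 153 * z^4 - 10 * z^2 + 1}"

text \<open>Together with \<open>jadd_y\<close> this is Euler's addition theorem for the
  differential dz / y. It has the shape of the formula for sn (u + v), with 153 in the place of k^2
  and y in that of cn * dn.\<close>

definition jadd_z :: "rat \<Rightarrow> rat \<Rightarrow> rat \<Rightarrow> rat \<Rightarrow> rat" where
  "jadd_z z1 y1 z2 y2 = (z1 * y2 + y1 * z2) / (1 - 153 * z1^2 * z2^2)"

definition jadd_y :: "rat \<Rightarrow> rat \<Rightarrow> rat \<Rightarrow> rat \<Rightarrow> rat" where
  "jadd_y z1 y1 z2 y2 = ((1 + 153 * z1^2 * z2^2) * (y1 * y2 - 10 * z1 * z2)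
     + 306 * z1 * z2 * (z1^2 + z2^2)) / (1 - 153 * z1^2 * z2^2)^2"

definition jadd :: "rat \<times> rat \<Rightarrow> rat \<times> rat \<Rightarrow> rat \<times> rat" where
  "jadd p q = (jadd_z (fst p) (snd p) (fst q) (snd q), jadd_y (fst p) (snd p) (fst q) (snd q))"

definition jneg :: "rat \<times> rat \<Rightarrow> rat \<times> rat" where
  "jneg p = (- fst p, snd p)"

lemma jadd_denominator: "1 - 153 * (z1::rat)^2 * z2^2 \<noteq> 0"
  using one_minus_153_sq[of "z1 * z2"] by (simp add: power_mult_distrib mult.assoc)

text \<open>Weighted coordinates (A : B : D) with z = A / D and y = B / D^2 turn closure into a
  polynomial identity without division.\<close>

lemma jac_numerators:
  fixes z1 y1 z2 y2 :: rat
  assumes "y1^2 = 153 * z1^4 - 10 * z1^2 + 1" "y2^2 = 153 * z2^4 - 10 * z2^2 + 1"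
    and "D = 1 - 153 * z1^2 * z2^2" "A = z1 * y2 + y1 * z2"
    and "B = (1 + 153 * z1^2 * z2^2) * (y1 * y2 - 10 * z1 * z2) + 306 * z1 * z2 * (z1^2 + z2^2)"
  shows "B^2 = 153 * A^4 - 10 * A^2 * D^2 + D^4"
  using assms(1-2) unfolding assms(3-) by algebra

lemma jadd_closed:
  assumes "p \<in> jac" "q \<in> jac"
  shows "jadd p q \<in> jac"
proof -
  obtain z1 y1 z2 y2 where pq: "p = (z1, y1)" "q = (z2, y2)" by (cases p, cases q)
  define D where "D = 1 - 153 * z1^2 * z2^2"
  define A where "A = z1 * y2 + y1 * z2"
  define B where "B = (1 + 153 * z1^2 * z2^2) * (y1 * y2 - 10 * z1 * z2) + 306 * z1 * z2 * (z1^2 + z2^2)"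
  have "B^2 = 153 * A^4 - 10 * A^2 * D^2 + D^4"
    using assms by (intro jac_numerators[OF _ _ D_def A_def B_def]) (auto simp: jac_def pq)
  moreover have "D \<noteq> 0" using jadd_denominator by (simp add: D_def)
  ultimately have "B^2 / D^4 = 153 * (A / D)^4 - 10 * (A / D)^2 + 1"
    by (simp add: power_divide diff_divide_distrib add_divide_distrib power4_eq_xxxx power2_eq_square)
  then have "(B / D^2)^2 = 153 * (A / D)^4 - 10 * (A / D)^2 + 1"
    by (simp add: power_divide flip: power_mult)
  then show ?thesis
    by (simp add: jadd_def jadd_z_def jadd_y_def jac_def pq flip: A_def B_def D_def)
qed

lemma jadd_commute: "jadd p q = jadd q p"
  by (simp add: jadd_def jadd_z_def jadd_y_def algebra_simps)

lemma jadd_zero [simp]: "jadd (0, 1) p = p" "jadd p (0, 1) = p"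
  by (cases p; simp add: jadd_def jadd_z_def jadd_y_def)+

lemma jadd_T: "jadd (0, -1) p = (- fst p, - snd p)"
  by (cases p; simp add: jadd_def jadd_z_def jadd_y_def)

lemma jneg_closed: "p \<in> jac \<Longrightarrow> jneg p \<in> jac"
  by (auto simp: jac_def jneg_def)

lemma jadd_jneg:
  assumes "p \<in> jac"
  shows "jadd (jneg p) p = (0, 1)"
proof -
  obtain z y where p: "p = (z, y)" by (cases p)
  have "y^2 = 153 * z^4 - 10 * z^2 + 1" using assms by (simp add: jac_def p)
  then have "(1 + 153 * z^2 * z^2) * (y * y + 10 * z * z) - 306 * z * z * (z^2 + z^2) = (1 - 153 * z^2 * z^2)^2"
    by algebra
  then show ?thesis
    using jadd_denominator[of z z] by (simp add: p jneg_def jadd_def jadd_z_def jadd_y_def)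
qed

text \<open>Adding an affine point to one in weighted coordinates leaves a single denominator, so
  iterated sums can be compared by cross-multiplication.\<close>

lemma jadd_y_homogeneous:
  fixes A B D x y :: rat
  assumes "D \<noteq> 0"
  shows "jadd_z (A / D) (B / D^2) x y = (A * D * y + B * x) / (D^2 - 153 * A^2 * x^2)"
    and "jadd_y (A / D) (B / D^2) x y =
      ((D^2 + 153 * A^2 * x^2) * (B * y - 10 * A * D * x) + 306 * A * D * x * (A^2 + D^2 * x^2))
        / (D^2 - 153 * A^2 * x^2)^2"
proof -
  have M: "D^2 - 153 * A^2 * x^2 \<noteq> 0" "1 - 153 * (A / D)^2 * x^2 \<noteq> 0"
    using jadd_denominator[of "A / D" x] assms by (auto simp: field_simps)
  have den: "1 - 153 * (A / D)^2 * x^2 = (D^2 - 153 * A^2 * x^2) / D^2"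
    using assms by (simp add: field_simps)
  have "A / D * y + B / D^2 * x = (A * D * y + B * x) / D^2"
    using assms by (simp add: field_simps power2_eq_square)
  then show "jadd_z (A / D) (B / D^2) x y = (A * D * y + B * x) / (D^2 - 153 * A^2 * x^2)"
    using assms M(1) unfolding jadd_z_def den by simp
  have num: "(1 + 153 * (A / D)^2 * x^2) * (B / D^2 * y - 10 * (A / D) * x) + 306 * (A / D) * x * ((A / D)^2 + x^2)
     = ((D^2 + 153 * A^2 * x^2) * (B * y - 10 * A * D * x) + 306 * A * D * x * (A^2 + D^2 * x^2)) / D^4"
    using assms by (simp add: divide_simps) algebra
  have "((D^2 - 153 * A^2 * x^2) / D^2)^2 = (D^2 - 153 * A^2 * x^2)^2 / D^4"
    by (simp add: power_divide)
  then show "jadd_y (A / D) (B / D^2) x y =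
      ((D^2 + 153 * A^2 * x^2) * (B * y - 10 * A * D * x) + 306 * A * D * x * (A^2 + D^2 * x^2))
        / (D^2 - 153 * A^2 * x^2)^2"
    using assms M(1) unfolding jadd_y_def den num by simp
qed

lemma jac_assoc_numerators:
  fixes z1 y1 z2 y2 z3 y3 :: rat
  assumes "y1^2 = 153 * z1^4 - 10 * z1^2 + 1" "y2^2 = 153 * z2^4 - 10 * z2^2 + 1"
      "y3^2 = 153 * z3^4 - 10 * z3^2 + 1"
    and "D = 1 - 153 * z1^2 * z2^2" "A = z1 * y2 + y1 * z2"
    and "B = (1 + 153 * z1^2 * z2^2) * (y1 * y2 - 10 * z1 * z2) + 306 * z1 * z2 * (z1^2 + z2^2)"
    and "D' = 1 - 153 * z2^2 * z3^2" "A' = z2 * y3 + y2 * z3"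
    and "B' = (1 + 153 * z2^2 * z3^2) * (y2 * y3 - 10 * z2 * z3) + 306 * z2 * z3 * (z2^2 + z3^2)"
  shows "(A * D * y3 + B * z3) * (D'^2 - 153 * A'^2 * z1^2)
      = (A' * D' * y1 + B' * z1) * (D^2 - 153 * A^2 * z3^2)" (is ?z)
    and "((D^2 + 153 * A^2 * z3^2) * (B * y3 - 10 * A * D * z3) + 306 * A * D * z3 * (A^2 + D^2 * z3^2))
        * (D'^2 - 153 * A'^2 * z1^2)^2
      = ((D'^2 + 153 * A'^2 * z1^2) * (B' * y1 - 10 * A' * D' * z1) + 306 * A' * D' * z1 * (A'^2 + D'^2 * z1^2))
        * (D^2 - 153 * A^2 * z3^2)^2" (is ?y)
proof -
  show ?z using assms(1-3) unfolding assms(4-) by algebra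
  show ?y using assms(1-3) unfolding assms(4-) by algebra
qed

lemma jadd_assoc:
  assumes "p \<in> jac" "q \<in> jac" "r \<in> jac"
  shows "jadd (jadd p q) r = jadd p (jadd q r)"
proof -
  obtain z1 y1 z2 y2 z3 y3 where pqr: "p = (z1, y1)" "q = (z2, y2)" "r = (z3, y3)"
    by (cases p, cases q, cases r)
  define D where "D = 1 - 153 * z1^2 * z2^2"
  define A where "A = z1 * y2 + y1 * z2"
  define B where "B = (1 + 153 * z1^2 * z2^2) * (y1 * y2 - 10 * z1 * z2) + 306 * z1 * z2 * (z1^2 + z2^2)"
  define D' where "D' = 1 - 153 * z2^2 * z3^2"
  define A' where "A' = z2 * y3 + y2 * z3"
  define B' where "B' = (1 + 153 * z2^2 * z3^2) * (y2 * y3 - 10 * z2 * z3) + 306 * z2 * z3 * (z2^2 + z3^2)"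
  have D: "D \<noteq> 0" "D' \<noteq> 0" using jadd_denominator by (simp_all add: D_def D'_def)
  have M: "D^2 - 153 * A^2 * z3^2 \<noteq> 0" "D'^2 - 153 * A'^2 * z1^2 \<noteq> 0"
    using jadd_denominator[of "A / D" z3] jadd_denominator[of "A' / D'" z1] D
    by (auto simp: field_simps)
  have pq: "jadd p q = (A / D, B / D^2)" and qr: "jadd q r = (A' / D', B' / D'^2)"
    by (simp_all add: pqr jadd_def jadd_z_def jadd_y_def A_def A'_def B_def B'_def D_def D'_def)
  note num = jac_assoc_numerators[OF _ _ _ D_def A_def B_def D'_def A'_def B'_def]
  \<comment> \<open>The right-hand side is commuted so that on both sides the compound sum is the
    first argument, the one that \<open>jadd_y_homogeneous\<close> treats.\<close>
  have "jadd (jadd p q) r = jadd (jadd q r) p"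
    unfolding pq qr unfolding pqr jadd_def fst_conv snd_conv jadd_y_homogeneous[OF D(1)] jadd_y_homogeneous[OF D(2)]
    using M assms num by (simp add: pqr jac_def frac_eq_eq)
  then show ?thesis by (simp add: jadd_commute)
qed

definition jac_group :: "(rat \<times> rat) monoid" where
  "jac_group = \<lparr> carrier = jac, monoid.mult = jadd, one = (0, 1) \<rparr>"

lemma jac_group_simps [simp]:
  "carrier jac_group = jac" "x \<otimes>\<^bsub>jac_group\<^esub> y = jadd x y" "\<one>\<^bsub>jac_group\<^esub> = (0, 1)"
  by (simp_all add: jac_group_def)

lemma comm_group_jac_group: "comm_group jac_group"
proof (rule comm_groupI, simp_all add: jadd_closed jadd_assoc)
  show "(0, 1) \<in> jac" by (simp add: jac_def)
  show "jadd x y = jadd y x" for x y by (rule jadd_commute)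
  show "\<exists>y\<in>jac. jadd y x = (0, 1)" if "x \<in> jac" for x
    using that jadd_jneg jneg_closed by blast
qed

subsection \<open>Commensurability and rank in abelian groups\<close>

text \<open>The bound \<open>max (h P) C\<close> is reproduced by every halving step, so all
  remainders stay in one finite set. A recurrence f k = f l then becomes an equation for the single
  element s = f k \<otimes> f k, with exponent 1 - 2 ^ (l - k).\<close>

lemma (in comm_group) descent_imp_commensurable:
  fixes h :: "'a \<Rightarrow> 'c::linorder" and C :: 'c
  assumes g: "g \<in> carrier G" and T: "T \<in> carrier G" "T \<otimes> T = \<one>"
    and fin: "\<And>B. finite {P \<in> carrier G. h P \<le> B}"
    and step: "\<And>P. P \<in> carrier G \<Longrightarrow>
      \<exists>P'\<in>carrier G. \<exists>R\<in>{\<one>, T, g, g \<otimes> T}. P = R \<otimes> (P' \<otimes> P') \<and> h P' \<le> max (h P) C"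
    and P: "P \<in> carrier G"
  shows "\<exists>(N::int) m::int. N \<noteq> 0 \<and> P [^] N = g [^] m"
proof -
  let ?Q = "\<lambda>_::nat. \<lambda>x y. \<exists>R\<in>{\<one>, T, g, g \<otimes> T}. x = R \<otimes> (y \<otimes> y)"
  have "\<exists>f. \<forall>n. (f n \<in> carrier G \<and> h (f n) \<le> max (h P) C \<and> (n = 0 \<longrightarrow> f n = P)) \<and> ?Q n (f n) (f (Suc n))"
  proof (rule dependent_nat_choice)
    show "\<exists>x. x \<in> carrier G \<and> h x \<le> max (h P) C \<and> (0 = 0 \<longrightarrow> x = P)"
      using P by auto
  next
    fix x and n :: nat
    assume x: "x \<in> carrier G \<and> h x \<le> max (h P) C \<and> (n = 0 \<longrightarrow> x = P)"
    with step[of x] obtain y R where "y \<in> carrier G" "R \<in> {\<one>, T, g, g \<otimes> T}" "x = R \<otimes> (y \<otimes> y)"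
      "h y \<le> max (h x) C" by blast
    moreover from this have "h y \<le> max (h P) C" using x by (auto simp: le_max_iff_disj)
    ultimately show "\<exists>y. (y \<in> carrier G \<and> h y \<le> max (h P) C \<and> (Suc n = 0 \<longrightarrow> y = P)) \<and> ?Q n x y" by auto
  qed
  then obtain f where f: "\<And>n. f n \<in> carrier G" "\<And>n. h (f n) \<le> max (h P) C" "f 0 = P"
      and fQ: "\<And>n. ?Q n (f n) (f (Suc n))" by blast
  \<comment> \<open>Squaring the relation between consecutive remainders kills T, so only a power of
    g is left over.\<close>
  have sq: "\<exists>m::int. f n \<otimes> f n = g [^] m \<otimes> (f (Suc n) \<otimes> f (Suc n)) [^] (2::int)" for n
  proof -
    obtain R where R: "R \<in> {\<one>, T, g, g \<otimes> T}" "f n = R \<otimes> (f (Suc n) \<otimes> f (Suc n))" using fQ by blast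
    then have Rc: "R \<in> carrier G" using g T by auto
    have two: "x \<otimes> x = x [^] (2::int)" if "x \<in> carrier G" for x
      using int_pow_mult[OF that, of 1 1] that by simp
    have T2: "T [^] (2::int) = \<one>" using two[OF T(1)] T(2) by simp
    have "\<exists>m::int. R [^] (2::int) = g [^] m"
    proof -
      have "\<one> [^] (2::int) = g [^] (0::int)" "T [^] (2::int) = g [^] (0::int)"
        "(g \<otimes> T) [^] (2::int) = g [^] (2::int)"
        using g T T2 by (auto simp: int_pow_distrib)
      with R(1) show ?thesis by blast
    qed
    then obtain m :: int where "R [^] (2::int) = g [^] m" ..
    then have "f n [^] (2::int) = g [^] m \<otimes> (f (Suc n) \<otimes> f (Suc n)) [^] (2::int)"
      using R(2) Rc f(1) by (simp add: int_pow_distrib)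
    then show ?thesis using two f(1) by metis
  qed
  have sqs: "\<exists>m::int. f n \<otimes> f n = g [^] m \<otimes> (f (n + j) \<otimes> f (n + j)) [^] (2 ^ j :: int)" for n j
  proof (induction j)
    case 0
    show ?case using f(1) g by (intro exI[of _ 0]) simp
  next
    case (Suc j)
    then obtain m :: int where m: "f n \<otimes> f n = g [^] m \<otimes> (f (n + j) \<otimes> f (n + j)) [^] (2 ^ j :: int)" ..
    obtain l :: int where l: "f (n + j) \<otimes> f (n + j) = g [^] l \<otimes> (f (Suc (n + j)) \<otimes> f (Suc (n + j))) [^] (2::int)"
      using sq by blast
    have "f n \<otimes> f n = g [^] (m + l * 2 ^ j) \<otimes> (f (n + Suc j) \<otimes> f (n + Suc j)) [^] (2 ^ Suc j :: int)"
      unfolding m l using f(1) g by (simp add: int_pow_distrib int_pow_pow int_pow_mult m_assoc)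
    then show ?case ..
  qed
  have "\<not> inj f"
  proof
    assume "inj f"
    moreover have "finite (range f)"
      by (rule finite_subset[OF _ fin[of "max (h P) C"]]) (use f in auto)
    ultimately show False using finite_imageD by blast
  qed
  then obtain k l where kl: "k < l" "f k = f l"
    unfolding inj_def by (metis linorder_neqE_nat)
  define s where "s = f k \<otimes> f k"
  have s: "s \<in> carrier G" using f by (simp add: s_def)
  obtain m :: int where "s = g [^] m \<otimes> s [^] (2 ^ (l - k) :: int)"
    using sqs[of k "l - k"] kl by (auto simp: s_def)
  then have "s \<otimes> inv (s [^] (2 ^ (l - k) :: int)) = g [^] m"
    using s g by (metis int_pow_closed inv_solve_right)
  then have N: "s [^] (1 - 2 ^ (l - k) :: int) = g [^] m"
    using s int_pow_diff[OF s, of 1 "2 ^ (l - k)"] by simp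
  define N :: int where "N = 1 - 2 ^ (l - k)"
  have "N \<noteq> 0"
  proof -
    have "(1::int) < 2 ^ (l - k)" using kl(1) by (intro one_less_power) auto
    then have "N < 0" unfolding N_def by linarith
    then show ?thesis by simp
  qed
  obtain m' :: int where m': "P \<otimes> P = g [^] m' \<otimes> s [^] (2 ^ k :: int)"
    using sqs[of 0 k] f(3) by (auto simp: s_def)
  have "(s [^] (2 ^ k :: int)) [^] N = (s [^] N) [^] (2 ^ k :: int)"
    using s by (simp add: int_pow_pow mult.commute)
  then have "(P \<otimes> P) [^] N = g [^] (m' * N + m * 2 ^ k)"
    unfolding m' using s g N int_pow_pow[OF s, of N "2 ^ k"] int_pow_pow[OF g, of m "2 ^ k"]
    by (simp add: int_pow_distrib int_pow_pow int_pow_mult flip: N_def)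
  moreover have "(P \<otimes> P) [^] N = P [^] (2 * N)"
    unfolding mult_2 int_pow_distrib[OF P P] int_pow_mult[OF P] ..
  ultimately show ?thesis using \<open>N \<noteq> 0\<close> by (metis mult_eq_0_iff zero_neq_numeral)
qed

lemma (in comm_group) abelian_rank_eq_1:
  assumes Q: "Q \<in> carrier G" "\<And>n::int. Q [^] n = \<one> \<Longrightarrow> n = 0"
    and g: "g \<in> carrier G"
    and comm: "\<And>P. P \<in> carrier G \<Longrightarrow> \<exists>(N::int) m::int. N \<noteq> 0 \<and> P [^] N = g [^] m"
  shows "abelian_rank G = 1"
proof (rule antisym)
  have "int_independent G {Q}"
    unfolding int_independent_def
  proof (intro allI impI)
    fix n :: "'a \<Rightarrow> int"
    assume "finprod G (\<lambda>x. x [^] n x) {Q} = \<one>"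
    then have "Q [^] n Q = \<one>" using Q(1) finprod_insert[of "{}" Q "\<lambda>x. x [^] n x"] by simp
    then show "\<forall>x\<in>{Q}. n x = 0" using Q(2) by simp
  qed
  then have "enat (card {Q}) \<le> abelian_rank G"
    unfolding abelian_rank_def using Q(1) by (intro SUP_upper) auto
  then show "1 \<le> abelian_rank G" by (simp add: one_enat_def)
next
  show "abelian_rank G \<le> 1"
    unfolding abelian_rank_def
  proof (rule SUP_least, clarify)
    fix B assume B: "finite B" "B \<subseteq> carrier G" "int_independent G B"
    have "card B \<le> 1"
    proof (rule ccontr)
      assume "\<not> card B \<le> 1"
      then obtain P R where PR: "P \<in> B" "R \<in> B" "P \<noteq> R"
        using B(1) card_le_Suc0_iff_eq by (metis One_nat_def)
      then have c: "P \<in> carrier G" "R \<in> carrier G" using B(2) by auto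
      obtain N m :: int where N: "N \<noteq> 0" "P [^] N = g [^] m"
        using comm[OF c(1)] by blast
      obtain N' m' :: int where N': "N' \<noteq> 0" "R [^] N' = g [^] m'"
        using comm[OF c(2)] by blast
      have rel: "i = 0 \<and> j = 0" if "P [^] i \<otimes> R [^] j = \<one>" for i j :: int
      proof -
        define n where "n = (\<lambda>x. if x = P then i else if x = R then j else 0)"
        have "finprod G (\<lambda>x. x [^] n x) B = finprod G (\<lambda>x. x [^] n x) {P, R}"
          using B PR by (intro finprod_mono_neutral_cong_left[symmetric]) (auto simp: n_def)
        also have "\<dots> = P [^] i \<otimes> R [^] j"
          using PR(3) c by (simp add: n_def)
        finally have "\<forall>x\<in>B. n x = 0" using B(3) that unfolding int_independent_def by metis
        then show ?thesis using PR by (auto simp: n_def)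
      qed
      \<comment> \<open>Since P^N and R^N' are the powers m and m' of g, cross-multiplied exponents
        cancel. Independence gives m = 0, after which P^N = 1 is itself a forbidden
        relation.\<close>
      have "P [^] (N * m') \<otimes> R [^] (- N' * m) = g [^] (m * m') \<otimes> g [^] (- (m' * m))"
        using int_pow_pow[OF c(1), of N m'] int_pow_pow[OF c(2), of N' "- m"] int_pow_pow[OF g, of m' "- m"]
          int_pow_pow[OF g, of m m'] N(2) N'(2) by simp
      also have "\<dots> = \<one>" using g by (simp add: mult.commute flip: int_pow_mult)
      finally have "m = 0" using rel N'(1) by force
      then have "P [^] N \<otimes> R [^] (0::int) = \<one>" using N(2) c by simp
      then show False using rel N(1) by blast
    qed
    then show "enat (card B) \<le> 1" by (simp add: one_enat_def)
  qed
qed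

subsection \<open>The 2-descent\<close>

text \<open>A square q^2 dividing a is removed by induction, with q leaving c. For squarefree a, a
  prime q \<noteq> p dividing a does not divide b, so its even exponent in p c^2 would put q^2 into
  a; hence a is 1 or p.\<close>

lemma square_or_prime_times_square:
  fixes a b c p :: nat
  assumes "prime p" "0 < c" "a * b = p * c^2" "\<And>q. prime q \<Longrightarrow> q dvd a \<Longrightarrow> q dvd b \<Longrightarrow> q = p"
  shows "\<exists>s. a = s^2 \<or> a = p * s^2"
  using assms(2-)
proof (induction a arbitrary: c rule: less_induct)
  case (less a)
  have a: "a > 0" using less.prems(1,2) assms(1) by (metis gr0I mult_is_0 not_prime_0 power_eq_0_iff)
  show ?case
  proof (cases "\<exists>q. prime q \<and> q^2 dvd a")
    case True
    then obtain q a' where q: "prime q" and a': "a = q^2 * a'" by (auto elim: dvdE)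
    have "q dvd c"
    proof (cases "q = p")
      case True
      have "p * (p * a' * b) = p * c^2" using less.prems(2) a' True by (simp add: power2_eq_square mult_ac)
      then have "p * a' * b = c^2" using assms(1) by simp
      then have "p dvd c^2" by (metis dvd_triv_left mult.assoc)
      then show ?thesis using True assms(1) prime_dvd_power by blast
    next
      case False
      have "q dvd p * c^2" using less.prems(2) a' by (metis dvd_mult2 dvd_triv_left dvd_power zero_less_numeral)
      then have "q dvd c^2" using q assms(1) False by (metis prime_dvd_mult_iff primes_dvd_imp_eq)
      then show ?thesis using q prime_dvd_power by blast
    qed
    then obtain c' where c': "c = q * c'" ..
    have "q^2 * (a' * b) = q^2 * (p * c'^2)"
      using less.prems(2) a' c' by (simp add: power_mult_distrib mult_ac)
    then have "a' * b = p * c'^2" using q by simp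
    moreover have "a' < a" using a a' prime_gt_1_nat[OF q]
      by (metis mult_less_cancel2 mult_1 one_less_power zero_less_numeral mult_pos_pos gr0I mult_is_0)
    moreover have "c' > 0" using less.prems(1) c' by auto
    moreover have "\<And>r. prime r \<Longrightarrow> r dvd a' \<Longrightarrow> r dvd b \<Longrightarrow> r = p"
      using less.prems(3) a' by simp
    ultimately obtain s where "a' = s^2 \<or> a' = p * s^2" using less.IH by blast
    then have "a = (q * s)^2 \<or> a = p * (q * s)^2"
      using a' by (auto simp: power_mult_distrib)
    then show ?thesis by blast
  next
    case sqfree: False
    have only_p: "q = p" if q: "prime q" "q dvd a" for q
    proof (rule ccontr)
      assume "q \<noteq> p"
      then have nb: "\<not> q dvd b" using q less.prems(3) by blast
      have "q dvd p * c^2" using less.prems(2) q(2) by (metis dvd_mult2)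
      then have "q dvd c" using q(1) assms(1) \<open>q \<noteq> p\<close>
        by (metis prime_dvd_mult_iff primes_dvd_imp_eq prime_dvd_power)
      then have "q^2 dvd p * c^2" by (simp add: dvd_mult)
      then have "q^2 dvd a * b" using less.prems(2) by simp
      moreover have "coprime (q^2) b" using nb q(1) by (simp add: prime_imp_coprime)
      ultimately have "q^2 dvd a" by (simp add: coprime_dvd_mult_left_iff)
      then show False using sqfree q(1) by blast
    qed
    show ?thesis
    proof (cases "a = 1")
      case True
      then show ?thesis by (intro exI[of _ 1]) simp
    next
      case False
      then obtain q where "prime q" "q dvd a" using prime_factor_nat by blast
      then obtain a' where a': "a = p * a'" using only_p by (metis dvdE)
      have "a' = 1"
      proof (rule ccontr)
        assume "a' \<noteq> 1"
        then obtain q where "prime q" "q dvd a'" using prime_factor_nat by blast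
        moreover from this have "q = p" using only_p a' by simp
        ultimately have "p^2 dvd a" using a' by (simp add: power2_eq_square)
        then show False using sqfree assms(1) by blast
      qed
      then show ?thesis using a' by (intro exI[of _ 1]) simp
    qed
  qed
qed

lemma int_square_or_prime_times_square:
  fixes a b c p :: int
  assumes "prime p" "c \<noteq> 0" "\<bar>a * b\<bar> = p * c^2" "\<And>q. prime q \<Longrightarrow> q dvd a \<Longrightarrow> q dvd b \<Longrightarrow> q = p"
  shows "\<exists>s. \<bar>a\<bar> = s^2 \<or> \<bar>a\<bar> = p * s^2"
proof -
  have p: "p > 0" using assms(1) by (simp add: prime_gt_0_int)
  have "nat \<bar>a\<bar> * nat \<bar>b\<bar> = nat \<bar>a * b\<bar>" by (simp add: abs_mult nat_mult_distrib)
  also have "\<dots> = nat p * (nat \<bar>c\<bar>)^2"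
    using p assms(3) by (simp add: nat_mult_distrib nat_power_eq flip: nat_abs_mult_distrib)
      (metis nat_power_eq abs_ge_zero power2_abs)
  finally have "nat \<bar>a\<bar> * nat \<bar>b\<bar> = nat p * (nat \<bar>c\<bar>)^2" .
  moreover have "q = nat p" if "prime q" "q dvd nat \<bar>a\<bar>" "q dvd nat \<bar>b\<bar>" for q
    using that assms(4)[of "int q"] by (auto simp: dvd_nat_abs_iff)
  ultimately obtain s where "nat \<bar>a\<bar> = s^2 \<or> nat \<bar>a\<bar> = nat p * s^2"
    using square_or_prime_times_square[of "nat p" "nat \<bar>c\<bar>" "nat \<bar>a\<bar>" "nat \<bar>b\<bar>"] assms(1,2) by auto
  then have "\<bar>a\<bar> = (int s)^2 \<or> \<bar>a\<bar> = p * (int s)^2"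
    using p by (metis abs_ge_zero int_nat_eq less_imp_le of_nat_mult of_nat_power)
  then show ?thesis by blast
qed

lemma rat_square_int_imp_int:
  fixes x :: rat
  assumes "x^2 = of_int k"
  obtains n :: int where "x = of_int n"
proof -
  obtain p q :: int where q: "q > 0" "coprime p q" "x = of_int p / of_int q" by (rule rat_coprime_cases)
  then have "(of_int p)^2 = x^2 * (of_int q)^2" by (simp add: power_divide)
  then have "(of_int (p^2) :: rat) = of_int (k * q^2)" using assms by simp
  then have "p^2 = k * q^2" unfolding of_int_eq_iff .
  then have "q^2 dvd p^2" by simp
  then have "q dvd p" by simp
  then have "q = 1" using q by (metis coprime_absorb_right zdvd1_eq abs_of_pos)
  then show ?thesis using that q by simp
qed

text \<open>The number y e^2 is a rational square root of an integer, hence an integer, so every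
  rational point is an integral solution with coprime m and e.\<close>

lemma jac_cases:
  assumes "(z, y) \<in> jac"
  obtains m e n :: int where "e > 0" "coprime m e" "z = of_int m / of_int e" "y = of_int n / of_int e^2"
    "n^2 = 153 * m^4 - 10 * m^2 * e^2 + e^4"
proof -
  obtain m e :: int where e: "e > 0" "coprime m e" "z = of_int m / of_int e" by (rule rat_coprime_cases)
  have "y^2 = 153 * z^4 - 10 * z^2 + 1" using assms by (simp add: jac_def)
  then have "(y * of_int e^2)^2 = 153 * (z * of_int e)^4 - 10 * (z * of_int e)^2 * of_int e^2 + of_int e^4"
    by algebra
  moreover have "z * of_int e = of_int m" using e by simp
  ultimately have 1: "(y * of_int e^2)^2 = of_int (153 * m^4 - 10 * m^2 * e^2 + e^4)" by simp
  then obtain n where n: "y * of_int e^2 = of_int n" by (rule rat_square_int_imp_int)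
  then have "(of_int (n^2) :: rat) = of_int (153 * m^4 - 10 * m^2 * e^2 + e^4)" using 1 by simp
  then have "n^2 = 153 * m^4 - 10 * m^2 * e^2 + e^4" unfolding of_int_eq_iff .
  moreover have "y = of_int n / of_int e^2" using n e(1) by (simp add: field_simps)
  ultimately show ?thesis using that e by blast
qed

(* Since 1 + y - 5 z^2 = 2 z^2 X, this computes the class of 2 X modulo squares, X being the Weierstrass coordinate. *)
lemma jac_class:
  assumes "(z, y) \<in> jac" "z \<noteq> 0"
  shows "\<exists>s d. d \<in> {1, -1, 2, -2} \<and> s \<noteq> 0 \<and> 1 + y - 5 * z^2 = d * s^2"
proof -
  obtain m e n :: int where e: "e > 0" "coprime m e" "z = of_int m / of_int e" "y = of_int n / of_int e^2"
    and n: "n^2 = 153 * m^4 - 10 * m^2 * e^2 + e^4"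
    using jac_cases[OF assms(1)] .
  have m: "m \<noteq> 0" using e assms(2) by auto
  define U where "U = e^2 + n - 5 * m^2"
  define V where "V = e^2 - n - 5 * m^2"
  \<comment> \<open>The product is (e^2 - 5 m^2)^2 - n^2 = -128 m^4 with 128 = 2 * 8^2. A common odd
    prime of U and V would divide m and, through U + V, also e.\<close>
  have UV: "U * V = - (2 * (8 * m^2)^2)" using n unfolding U_def V_def by algebra
  have p2: "prime (2::int)" by simp
  have "q = 2" if q: "prime q" "q dvd U" "q dvd V" for q :: int
  proof (rule ccontr)
    assume "q \<noteq> 2"
    then have q2: "\<not> q dvd 2" using q(1) primes_dvd_imp_eq p2 by blast
    have "q dvd U * V" using q by simp
    then have "q dvd 2 * (2^3 * m^2)^2" unfolding UV by simp
    then have "q dvd m" using q2 q(1) by (metis prime_dvd_mult_iff prime_dvd_power)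
    have "q dvd U + V" using q by simp
    then have "q dvd 2 * (e^2 - 5 * m^2)" by (simp add: U_def V_def algebra_simps)
    then have "q dvd e^2 - 5 * m^2" using q2 q(1) prime_dvd_mult_iff by blast
    then have "q dvd (e^2 - 5 * m^2) + 5 * m^2" using \<open>q dvd m\<close> by (intro dvd_add) (auto simp: power2_eq_square)
    then have "q dvd e" using q(1) prime_dvd_power by simp blast
    then show False using \<open>q dvd m\<close> e(2) q(1) coprime_common_divisor not_prime_unit by blast
  qed
  then obtain s where s: "\<bar>U\<bar> = s^2 \<or> \<bar>U\<bar> = 2 * s^2"
    using int_square_or_prime_times_square[of 2 "8 * m^2" U V] UV m p2 by auto
  have "U \<noteq> 0" using UV m by auto
  then have "s \<noteq> 0" using s by auto
  obtain d :: int where d: "d \<in> {1, -1, 2, -2}" "U = d * s^2"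
    using s by (cases "U \<ge> 0") force+
  have "1 + y - 5 * z^2 = of_int U / of_int e^2"
    using e(1) by (simp add: e(3,4) U_def power_divide add_divide_distrib diff_divide_distrib)
  also have "\<dots> = of_int d * (of_int s / of_int e)^2" by (simp add: d(2) power_divide)
  finally show ?thesis using d(1) \<open>s \<noteq> 0\<close> e(1)
    by (intro exI[of _ "of_int s / of_int e"] exI[of _ "of_int d"]) auto
qed

text \<open>The product is 17 (3 f^2)^2, and a and b are coprime: a common prime q does not divide
  f, so q^2 divides 153 = 3^2 * 17 and q = 3. But 10 f^2 + k^2 is f^2 + k^2 modulo 3, and -1 is not
  a square there, so 3 would divide f. Here a / f^2 and b / f^2 play the part of the X-coordinates
  of the two preimages.\<close>

lemma second_descent:
  fixes a b f k :: int
  assumes "a > 0" "b > 0" "a * b = 153 * f^4" "a + b = 10 * f^2 + k^2" "coprime f k" "f \<noteq> 0"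
  shows "\<exists>s. a = s^2 \<or> a = 17 * s^2"
proof -
  have p3: "prime (3::int)" and p17: "prime (17::int)" by (simp_all add: prime_int_numeral_eq)
  have "False" if q: "prime q" "q dvd a" "q dvd b" for q
  proof -
    have nf: "\<not> q dvd f"
    proof
      assume "q dvd f"
      have "q dvd 10 * f^2 + k^2" using q assms(4) by (metis dvd_add)
      then have "q dvd k^2" using \<open>q dvd f\<close> by (simp add: dvd_add_right_iff power2_eq_square)
      then have "q dvd k" using q(1) prime_dvd_power by blast
      then show False using \<open>q dvd f\<close> assms(5) q(1) coprime_common_divisor not_prime_unit by blast
    qed
    have "q^2 dvd 153 * f^4" using q(2,3) by (metis assms(3) mult_dvd_mono power2_eq_square)
    moreover have "coprime (q^2) (f^4)" using nf q(1) by (simp add: prime_imp_coprime)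
    ultimately have d: "q^2 dvd 153" by (simp add: coprime_dvd_mult_left_iff)
    then have "q dvd 3^2 * 17" by (simp add: power2_eq_square dvd_mult_left)
    then have "q = 3 \<or> q = 17"
      using q(1) p3 p17 by (metis prime_dvd_mult_iff prime_dvd_power primes_dvd_imp_eq)
    then have "q = 3" using d by auto
    then have "3 dvd 10 * f^2 + k^2" using q assms(4) by (metis dvd_add)
    then have "(10 * f^2 + k^2) mod 3 = 0" by simp
    then have "(f^2 + k^2) mod 3 = 0" by presburger
    moreover have "f mod 3 = 0 \<or> f mod 3 = 1 \<or> f mod 3 = 2" "k mod 3 = 0 \<or> k mod 3 = 1 \<or> k mod 3 = 2"
      by presburger+
    ultimately have "f mod 3 = 0"
      by (auto simp: power2_eq_square mod_add_eq[symmetric, of "f * f"] mod_mult_eq[symmetric, of f] mod_mult_eq[symmetric, of k])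
    then show False using nf \<open>q = 3\<close> by auto
  qed
  then have "\<exists>s. \<bar>a\<bar> = s^2 \<or> \<bar>a\<bar> = 17 * s^2"
    using assms by (intro int_square_or_prime_times_square[of 17 "3 * f^2" a b])
      (auto simp: prime_int_numeral_eq power_mult_distrib)
  then show ?thesis using assms(1) by simp
qed

(* Here r^2 is the X-coordinate of a point, and 5 + 2 r^2 + 2 \<epsilon> t that of a preimage under the dual
   2-isogeny; the two preimages have X-coordinates with product 153. *)
lemma descent_square:
  fixes r t :: rat
  assumes t: "t^2 = r^4 + 5 * r^2 - 32"
  shows "\<exists>w \<epsilon>. w \<noteq> 0 \<and> \<epsilon>^2 = 1 \<and> 5 + 2 * r^2 + 2 * \<epsilon> * t = w^2"
proof -
  obtain m e :: int where e: "e > 0" "coprime m e" "r = of_int m / of_int e" by (rule rat_coprime_cases)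
  have "(t * of_int e^2)^2 = (r * of_int e)^4 + 5 * (r * of_int e)^2 * of_int e^2 - 32 * of_int e^4"
    using t by algebra
  moreover have "r * of_int e = of_int m" using e by simp
  ultimately have 1: "(t * of_int e^2)^2 = of_int (m^4 + 5 * m^2 * e^2 - 32 * e^4)" by simp
  then obtain n where n: "t * of_int e^2 = of_int n" by (rule rat_square_int_imp_int)
  then have "(of_int (n^2) :: rat) = of_int (m^4 + 5 * m^2 * e^2 - 32 * e^4)" using 1 by simp
  then have n2: "n^2 = m^4 + 5 * m^2 * e^2 - 32 * e^4" unfolding of_int_eq_iff .
  obtain f k a b :: int where f: "a * b = 153 * f^4" "a + b = 10 * f^2 + k^2" "coprime f k" "f \<noteq> 0"
    and ab: "of_int f^2 * (5 + 2 * r^2 + 2 * t) = of_int a" "of_int f^2 * (5 + 2 * r^2 - 2 * t) = of_int b"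
  \<comment> \<open>The fraction k / f is 2 r in lowest terms, which is why the parity of e decides
    the choice; then 10 f^2 + k^2 is f^2 times the sum 10 + 4 r^2 of the two preimages.\<close>
  proof (cases "even e")
    case False
    show ?thesis
    proof (rule that[of "5 * e^2 + 2 * m^2 + 2 * n" "5 * e^2 + 2 * m^2 - 2 * n" e "2 * m"])
      show "(5 * e^2 + 2 * m^2 + 2 * n) * (5 * e^2 + 2 * m^2 - 2 * n) = 153 * e^4" using n2 by algebra
      show "coprime e (2 * m)" using e(2) False by (simp add: coprime_commute)
      show "of_int e^2 * (5 + 2 * r^2 + 2 * t) = of_int (5 * e^2 + 2 * m^2 + 2 * n)"
        "of_int e^2 * (5 + 2 * r^2 - 2 * t) = of_int (5 * e^2 + 2 * m^2 - 2 * n)"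
        using n e(1) by (simp_all add: e(3) power_divide algebra_simps)
    qed (use e in auto)
  next
    case True
    then obtain f where f: "e = 2 * f" by blast
    have "odd m" using e(2) True by (metis coprime_common_divisor odd_one)
    moreover have "n^2 = m^4 + 2 * (10 * m^2 * f^2 - 256 * f^4)" using n2 unfolding f by algebra
    then have "odd (n^2) \<longleftrightarrow> odd (m^4)" by simp
    ultimately have "even (m^2 + n)" by simp
    then obtain l where l: "m^2 + n = 2 * l" by blast
    then have n': "n = 2 * l - m^2" by simp
    show ?thesis
    proof (rule that[of "5 * f^2 + l" "5 * f^2 + m^2 - l" f m])
      show "(5 * f^2 + l) * (5 * f^2 + m^2 - l) = 153 * f^4"
        using n2 unfolding f n' by algebra
      show "coprime f m" using e(2) f by (simp add: coprime_commute)
      have "of_int f^2 * r^2 = of_int m^2 / 4" "of_int f^2 * t = of_int n / 4"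
        using n e(1) by (simp_all add: e(3) f power_divide mult_ac)
      then show "of_int f^2 * (5 + 2 * r^2 + 2 * t) = of_int (5 * f^2 + l)"
        "of_int f^2 * (5 + 2 * r^2 - 2 * t) = of_int (5 * f^2 + m^2 - l)"
        by (simp_all add: algebra_simps n')
    qed (use e f in auto)
  qed
  have "a * b > 0" using f by simp
  moreover have "a + b > 0" using f by (simp add: add_pos_nonneg)
  ultimately have pos: "a > 0" "b > 0" by (auto simp: zero_less_mult_iff)
  then obtain s where s: "a = s^2 \<or> a = 17 * s^2" using second_descent f by blast
  have s0: "s \<noteq> 0" using s pos by auto
  from s show ?thesis
  proof
    assume "a = s^2"
    then have "5 + 2 * r^2 + 2 * 1 * t = (of_int s / of_int f)^2"
      using ab(1) f(4) by (simp add: power_divide field_simps)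
    then show ?thesis using s0 f(4) by (metis divide_eq_0_iff of_int_eq_0_iff one_power2)
  next
    assume a: "a = 17 * s^2"
    \<comment> \<open>The class 17 is that of 153, the product of the two preimages. So the other
      preimage, belonging to \<epsilon> = -1, is the square.\<close>
    then have "b * s^2 = 9 * f^4" using f(1) by simp
    then have "of_int b * of_int s^2 = (9 * of_int f^4 :: rat)" by (metis of_int_mult of_int_power of_int_numeral)
    then have "of_int b = (3 * of_int f^2 / of_int s :: rat)^2"
      using s0 by (simp add: power_divide power_mult_distrib field_simps flip: power_mult)
    then have "of_int f^2 * (5 + 2 * r^2 - 2 * t) = of_int f^2 * (3 * of_int f / of_int s)^2"
      unfolding ab(2) by (simp add: power_divide power_mult_distrib power2_eq_square mult_ac)
    then have "5 + 2 * r^2 + 2 * (- 1) * t = (3 * of_int f / of_int s)^2"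
      using f(4) by simp
    then show ?thesis using s0 f(4)
      by (intro exI[of _ "3 * of_int f / of_int s"] exI[of _ "- 1"]) simp
  qed
qed

text \<open>The hypothesis says that X = (s / z)^2 is a square. With r^2 = X and t = Y / r,
  \<open>descent_square\<close> provides a preimage w^2 under the dual isogeny, and the half must
  satisfy 1 / z^2 = w^2.\<close>

lemma jac_halvable:
  assumes p: "(z, y) \<in> jac" "z \<noteq> 0" and s: "1 + y - 5 * z^2 = 2 * s^2" "s \<noteq> 0"
  shows "\<exists>p\<in>jac. (z, y) = jadd p p"
proof -
  define r where "r = s / z"
  define t where "t = r / z"
  have r0: "r \<noteq> 0" using assms by (simp add: r_def)
  have rz: "r * z = s" "t * z = r" using p by (simp_all add: r_def t_def)
  have y: "y = 2 * r^2 * z^2 + 5 * z^2 - 1" using s(1) rz(1) by algebra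
  have "z^2 * (z^2 * (r^4 + 5 * r^2 - 32) - r^2) = 0"
    using p(1) unfolding jac_def y by (simp, algebra)
  then have "z^2 * (r^4 + 5 * r^2 - 32) = r^2" using p(2) by simp
  then have "z^2 * (t^2 - (r^4 + 5 * r^2 - 32)) = 0" using rz by algebra
  then have t: "t^2 = r^4 + 5 * r^2 - 32" using p(2) by simp
  obtain w e where w: "w \<noteq> 0" "e^2 = 1" "5 + 2 * r^2 + 2 * e * t = w^2"
    using descent_square[OF t] by blast
  have t0: "t \<noteq> 0" using r0 rz by auto
  have e0: "e \<noteq> 0" using w(2) by auto
  have W: "w^4 - (10 + 4 * r^2) * w^2 + 153 = 0" using w(2,3) t by algebra
  \<comment> \<open>The two preimages w^2 and 153 / w^2 have sum 10 + 4 r^2 and difference 4 e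
    t.\<close>
  have W': "w^4 - 153 = 4 * e * t * w^2" using W w(2,3) t by algebra
  \<comment> \<open>The first coordinate inverts the isogeny. The second is a square root of (w^4 -
    10 w^2 + 153) / w^4 = (2 r / w)^2, and the sign e makes the double come out as z instead of
    -z.\<close>
  define p where "p = (1 / w, 2 * e * r / w)"
  have "w^4 - 10 * w^2 + 153 = 4 * r^2 * w^2" using W by algebra
  moreover have "(2 * e * r / w)^2 = 4 * r^2 / w^2" using w(2) by (simp add: power_divide power_mult_distrib)
  moreover have "153 * (1 / w)^4 - 10 * (1 / w)^2 + 1 = (w^4 - 10 * w^2 + 153) / w^4"
    using w(1) by (simp add: divide_simps power4_eq_xxxx power2_eq_square) 
  ultimately have "p \<in> jac"
    using w(1) by (simp add: jac_def p_def power4_eq_xxxx power2_eq_square)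
  have z: "z = r / t" using rz t0 by (simp add: field_simps)
  have D: "1 - 153 * (1 / w)^2 * (1 / w)^2 = 4 * e * t / w^2"
  proof -
    have "1 - 153 * (1 / w)^2 * (1 / w)^2 = (w^4 - 153) / w^4"
      using w(1) by (simp add: field_simps power4_eq_xxxx power2_eq_square)
    then show ?thesis unfolding W' using w(1) by (simp add: power4_eq_xxxx power2_eq_square)
  qed
  have 1: "jadd_z (1 / w) (2 * e * r / w) (1 / w) (2 * e * r / w) = z"
  proof -
    have "1 / w * (2 * e * r / w) + 2 * e * r / w * (1 / w) = 4 * e * r / w^2" by (simp add: power2_eq_square)
    then show ?thesis unfolding jadd_z_def D using w(1) e0 t0 by (simp add: z)
  qed
  have "(1 + 153 * (1 / w)^2 * (1 / w)^2) * (2 * e * r / w * (2 * e * r / w) - 10 * (1 / w) * (1 / w))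
      + 306 * (1 / w) * (1 / w) * ((1 / w)^2 + (1 / w)^2)
    = ((w^4 + 153) * (4 * e^2 * r^2 - 10) + 612 * w^2) * w^2 / w^8"
    using w(1) by (simp add: divide_simps) algebra
  \<comment> \<open>As w^4 + 153 = (10 + 4 r^2) w^2, the left side is (16 r^4 - 100 + 612) w^2.
    Since 512 = 16 * 32, the double has second coordinate (r^4 + 32) / t^2, which is (X^2 + 32) /
    (X^2 + 5 X - 32).\<close>
  also have "(w^4 + 153) * (4 * e^2 * r^2 - 10) + 612 * w^2 = w^2 * (16 * r^4 + 512)"
    using W w(2) by algebra
  finally have N: "(1 + 153 * (1 / w)^2 * (1 / w)^2) * (2 * e * r / w * (2 * e * r / w) - 10 * (1 / w) * (1 / w))
      + 306 * (1 / w) * (1 / w) * ((1 / w)^2 + (1 / w)^2) = (16 * r^4 + 512) / w^4"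
    using w(1) by (simp add: divide_simps) algebra
  have "y = (r^4 + 32) / t^2"
  proof -
    have "y * t^2 = 2 * r^2 * (t * z)^2 + 5 * (t * z)^2 - t^2" unfolding y by algebra
    also have "\<dots> = r^4 + 32" unfolding rz(2) t by algebra
    finally have "y * t^2 = r^4 + 32" .
    then show ?thesis using t0 by (simp add: field_simps)
  qed
  moreover have "(4 * e * t / w^2)^2 = 16 * t^2 / w^4"
    using w(2) by (simp add: power_divide power_mult_distrib flip: power_mult)
  ultimately have 2: "jadd_y (1 / w) (2 * e * r / w) (1 / w) (2 * e * r / w) = y"
    unfolding jadd_y_def N D using w(1) t0 by (simp add: frac_eq_eq)
  have "(z, y) = jadd p p" by (simp add: jadd_def p_def 1 2)
  then show ?thesis using \<open>p \<in> jac\<close> by blast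
qed

section \<open>Square classes of translates and cosets of the doubles\<close>

text \<open>For z \<noteq> 0 the factors are 2 z^2 X at the point and at its translate by T, whose
  X-coordinates have product -32.\<close>

lemma jac_u_conj:
  assumes "(z, y) \<in> jac"
  shows "(1 + y - 5 * z^2) * (1 - y - 5 * z^2) = - 128 * z^4"
  using assms unfolding jac_def by (simp, algebra)

text \<open>A, B, D are the weighted coordinates of P - g. The identity is the chord formula: the
  X-coordinates of three collinear points multiply to the square of the intercept of the line. With
  X(g) = 8 and 16 z^2 - (1 + y - 5 z^2) = 2 z^2 (8 - X), it shows that subtracting g changes the
  class of X by 2.\<close>

lemma jac_u_translate:
  fixes z y :: rat
  assumes y: "y^2 = 153 * z^4 - 10 * z^2 + 1"
    and "D = 1 - 17 * z^2" "A = 4 * z / 3 - y / 3"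
    and "B = (1 + 17 * z^2) * (4 * y / 3 + 10 * z / 3) - 102 * z * (1 / 9 + z^2)"
  shows "(D^2 + B - 5 * A^2) * (16 * z^2 - (1 + y - 5 * z^2))^2
    = 32 * (1 + y - 5 * z^2) * A^2 * (1 + 3 * z)^2"
  using y unfolding assms(2-) by algebra

text \<open>Here 2 X is a square, as it is for g. Subtracting g therefore makes X a square, and
  \<open>jac_halvable\<close> applies; what remains are the places where the chord formula
  degenerates.\<close>

lemma jac_coset_square:
  assumes q: "(z, y) \<in> jac" "z \<noteq> 0" and s: "1 + y - 5 * z^2 = s^2"
  shows "\<exists>R\<in>{(- 1 / 3, 4 / 3), (1 / 3, - 4 / 3)}. \<exists>p\<in>jac. jadd R (z, y) = jadd p p"
proof -
  have y: "y^2 = 153 * z^4 - 10 * z^2 + 1" using q by (simp add: jac_def)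
  have h: "(- 1 / 3, 4 / 3) \<in> jac" by (simp add: jac_def power_divide)
  obtain z' y' where q': "jadd (- 1 / 3, 4 / 3) (z, y) = (z', y')" by fastforce
  then have q'jac: "(z', y') \<in> jac" using jadd_closed[OF h q(1)] by simp
  have qT: "jadd (1 / 3, - 4 / 3) (z, y) = (- z', - y')"
    using jadd_assoc[of "(0, -1)" "(- 1 / 3, 4 / 3)" "(z, y)"] h q(1) q' by (simp add: jadd_T jac_def)
  have O: "\<exists>p\<in>jac. (0, 1) = jadd p p" by (rule bexI[of _ "(0, 1)"]) (auto simp: jac_def)
  define E where "E = 16 * z^2 - (1 + y - 5 * z^2)"
  show ?thesis
  proof (cases "z' = 0")
    case True
    then have "y' = 1 \<or> y' = - 1" using q'jac by (auto simp: jac_def power2_eq_1_iff)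
    then show ?thesis using True q' qT O by auto
  next
    case z': False
    show ?thesis
    proof (cases "E = 0")
      \<comment> \<open>E = 0 means X = 8, so the point is g or -g. The former would give z' = 0,
        and for -g the sum is visibly a double.\<close>
      case True
      then have yz: "y = 21 * z^2 - 1" by (simp add: E_def)
      have "z^2 * (288 * z^2 - 32) = 0" using y unfolding yz by algebra
      then have "z^2 = (1 / 3)^2" using q(2) by (simp add: power_divide)
      then have "z = 1 / 3 \<or> z = - 1 / 3" using power2_eq_iff by fastforce
      moreover have "y = 4 / 3" using yz \<open>z^2 = (1 / 3)^2\<close> by (simp add: power_divide)
      moreover have "z \<noteq> 1 / 3 \<or> y \<noteq> 4 / 3"
        using z' q' by (auto simp: jadd_def jadd_z_def)
      ultimately have "(z, y) = (- 1 / 3, 4 / 3)" by auto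
      then show ?thesis using h by (metis insertI1)
    next
      case False
      define D where "D = 1 - 17 * z^2"
      define A where "A = 4 * z / 3 - y / 3"
      define B where "B = (1 + 17 * z^2) * (4 * y / 3 + 10 * z / 3) - 102 * z * (1 / 9 + z^2)"
      have "D \<noteq> 0" using jadd_denominator[of "1 / 3" z] by (simp add: D_def power_divide)
      moreover have "z' = A / D" "y' = B / D^2"
        using q' by (auto simp: jadd_def jadd_z_def jadd_y_def A_def B_def D_def power_divide algebra_simps)
      ultimately have AB: "A = D * z'" "B = D^2 * y'" by simp_all
      have "D^2 * ((1 + y' - 5 * z'^2) * E^2) = (D^2 + B - 5 * A^2) * E^2" unfolding AB by algebra
      also have "\<dots> = 32 * s^2 * A^2 * (1 + 3 * z)^2"
        using jac_u_translate[OF y D_def A_def B_def] s by (simp add: E_def)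
      also have "\<dots> = D^2 * (2 * (4 * s * z' * (1 + 3 * z))^2)" unfolding AB by algebra
      finally have "(1 + y' - 5 * z'^2) * E^2 = 2 * (4 * s * z' * (1 + 3 * z))^2"
        using \<open>D \<noteq> 0\<close> by simp
      then have "1 + y' - 5 * z'^2 = 2 * (4 * s * z' * (1 + 3 * z) / E)^2"
        using False by (simp add: power_divide eq_divide_eq)
      moreover have "1 + y' - 5 * z'^2 \<noteq> 0" using jac_u_conj[OF q'jac] z' by auto
      ultimately have "\<exists>p\<in>jac. (z', y') = jadd p p"
        by (intro jac_halvable[OF q'jac z']) auto
      then show ?thesis using q' by auto
    qed
  qed
qed

text \<open>In 1 + y - 5 z^2 = d s^2 the value d = 2 makes X a square, and d = 1 is the class of g.
  Translation by T replaces d by -2 / d, which carries -1 to 2 and -2 to 1. The representatives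
  stand on the left-hand side, so they are the negatives of O, T, g and g + T.\<close>

lemma jac_coset:
  assumes "p \<in> jac"
  shows "\<exists>R\<in>{(0, 1), (0, - 1), (- 1 / 3, 4 / 3), (1 / 3, - 4 / 3)}. \<exists>p'\<in>jac. jadd R p = jadd p' p'"
proof -
  obtain z y where p: "p = (z, y)" by (cases p)
  have q: "(z, y) \<in> jac" using assms p by simp
  show ?thesis
  proof (cases "z = 0")
    case True
    then have "y = 1 \<or> y = - 1" using q by (auto simp: jac_def power2_eq_1_iff)
    moreover have "\<exists>p\<in>jac. (0, 1) = jadd p p" by (rule bexI[of _ "(0, 1)"]) (auto simp: jac_def)
    ultimately show ?thesis using True p by (auto simp: jadd_T)
  next
    case z: False
    obtain s d where d: "d \<in> {1, -1, 2, -2}" "s \<noteq> 0" "1 + y - 5 * z^2 = d * s^2"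
      using jac_class[OF q z] by blast
    have d0: "d \<noteq> 0" using d(1) by auto
    have qT: "(- z, - y) \<in> jac" using q by (simp add: jac_def)
    have "d * s^2 * (1 - y - 5 * z^2) = - 128 * z^4" using jac_u_conj[OF q] d(3) by simp
    then have "1 - y - 5 * z^2 = (- 128 * z^4) / (d * s^2)" using d(2) d0
      by (subst nonzero_eq_divide_eq) (simp_all add: mult.commute)
    also have "\<dots> = (- 2 / d) * (8 * z^2 / s)^2"
      using d0 d(2) by (simp add: power_divide power_mult_distrib field_simps flip: power_mult)
    finally have uT: "1 + (- y) - 5 * (- z)^2 = (- 2 / d) * (8 * z^2 / s)^2" by simp
    consider "d = 1" | "d = -1" | "d = 2" | "d = -2" using d(1) by blast
    then show ?thesis
    proof cases
      case 1
      then show ?thesis using jac_coset_square[OF q z, of s] d(3) p by auto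
    next
      case 2
      then have "\<exists>p\<in>jac. (- z, - y) = jadd p p"
        using uT d(2) z by (intro jac_halvable[OF qT, of "8 * z^2 / s"]) auto
      then show ?thesis by (auto simp: p jadd_T)
    next
      case 3
      then have "\<exists>p\<in>jac. (z, y) = jadd p p"
        using d z by (intro jac_halvable[OF q z]) auto
      then show ?thesis by (auto simp: p)
    next
      case 4
      have flip: "jadd (- a, b) (- z, - y) = jadd (a, - b) (z, y)" for a b
        by (simp add: jadd_def jadd_z_def jadd_y_def)
      have "\<exists>R\<in>{(- 1 / 3, 4 / 3), (1 / 3, - 4 / 3)}. \<exists>p\<in>jac. jadd R (- z, - y) = jadd p p"
        using uT z 4 by (intro jac_coset_square[OF qT, of "8 * z^2 / s"]) auto
      then show ?thesis using flip[of "1 / 3" "4 / 3"] flip[of "- 1 / 3" "- 4 / 3"] by (auto simp: p)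
    qed
  qed
qed

subsection \<open>Heights\<close>

text \<open>The naive multiplicative height of z alone; at most two points share a z, so bounded
  height still leaves finitely many points.\<close>

definition jht :: "rat \<times> rat \<Rightarrow> int" where
  "jht p = max \<bar>fst (quotient_of (fst p))\<bar> (snd (quotient_of (fst p)))"

lemma jht_eq:
  assumes "e > 0" "coprime m e" "z = of_int m / of_int e"
  shows "jht (z, y) = max \<bar>m\<bar> e"
proof -
  have "quotient_of z = (m, e)"
    using assms quotient_of_unique by (metis Fract_of_int_quotient quotient_of_Fract normalize_stable)
  then show ?thesis by (simp add: jht_def)
qed

lemma finite_jht_le: "finite {p \<in> jac. jht p \<le> B}"
proof -
  have fin: "finite {y :: rat. y^2 = c}" for c
  proof (cases "\<exists>y0. y0^2 = c")
    case True
    then obtain y0 where "y0^2 = c" ..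
    then have "{y. y^2 = c} \<subseteq> {y0, - y0}" by (auto simp: power2_eq_iff)
    then show ?thesis by (rule finite_subset) simp
  qed auto
  let ?Z = "(\<lambda>(m, e). of_int m / of_int e :: rat) ` ({- B..B} \<times> {0..B})"
  have "{p \<in> jac. jht p \<le> B} \<subseteq> (SIGMA z:?Z. {y. y^2 = 153 * z^4 - 10 * z^2 + 1})"
  proof
    fix p assume p: "p \<in> {p \<in> jac. jht p \<le> B}"
    obtain z y where zy: "p = (z, y)" by (cases p)
    obtain m e n :: int where e: "e > 0" "coprime m e" "z = of_int m / of_int e"
      using jac_cases p zy by blast
    then have "max \<bar>m\<bar> e \<le> B" using jht_eq[OF e, of y] p zy by simp
    then have "(m, e) \<in> {- B..B} \<times> {0..B}" using e(1) by auto
    then have "z \<in> ?Z" using e(3) by (intro image_eqI[of _ _ "(m, e)"]) auto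
    then show "p \<in> (SIGMA z:?Z. {y. y^2 = 153 * z^4 - 10 * z^2 + 1})"
      using p zy by (auto simp: jac_def)
  qed
  moreover have "finite \<dots>" by (intro finite_SigmaI fin) auto
  ultimately show ?thesis by (rule finite_subset)
qed

(* With M = m^2 and N = e^2 for z = m / e, F and G are the squares of the numerator and the
   denominator of z(2P); the cofactors come from their resultant. *)
lemma doubling_bezout:
  fixes M N :: int
  defines "F \<equiv> 4 * M * N * (153 * M^2 - 10 * M * N + N^2)" and "G \<equiv> (N^2 - 153 * M^2)^2"
  shows "2048 * N^7 = F * (3060 * N^3 + 117045 * (M * N^2) - 234090 * (M^2 * N) - 10744731 * M^3)
      + G * (2048 * N^3 - 12240 * (M * N^2) + 280908 * (M^2 * N))"
    and "47941632 * M^7 = F * (- 3 * N^3 - 10 * (M * N^2) + 765 * (M^2 * N) + 3060 * M^3)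
      + G * (12 * (M * N^2) - 80 * (M^2 * N) + 2048 * M^3)"
  unfolding F_def G_def by algebra+

text \<open>Each identity of \<open>doubling_bezout\<close> bounds a seventh power by F and G times
  cubic cofactors, and a cube cancels. The constant 11394122 is the sum of the absolute values of
  all coefficients of both cofactors in the first identity, and it dominates those of the
  second.\<close>

lemma doubling_lower_bound:
  fixes M N :: int
  assumes MN: "M \<ge> 0" "N > 0" and F: "F = 4 * M * N * (153 * M^2 - 10 * M * N + N^2)" "F \<ge> 0"
    and G: "G = (N^2 - 153 * M^2)^2"
  shows "max M N ^ 4 \<le> 11394122 * (F + G)"
proof -
  have G0: "G \<ge> 0" by (simp add: G)
  note bz = doubling_bezout(1)[of N M, folded F(1) G] doubling_bezout(2)[of M N, folded F(1) G]
  have cancel: "X^4 \<le> 11394122 * (F + G)"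
    if "X > 0" "k > 0" "k * X^7 = F * a + G * b" "a \<le> 11394122 * X^3" "b \<le> 11394122 * X^3" for X k a b :: int
  proof -
    have "X^7 \<le> k * X^7" using that(1,2) by simp
    also have "\<dots> \<le> F * (11394122 * X^3) + G * (11394122 * X^3)"
      unfolding that(3) using that(4,5) F(2) G0 by (intro add_mono mult_left_mono)
    finally have "X^3 * X^4 \<le> X^3 * (11394122 * (F + G))" by (simp add: algebra_simps flip: power_add)
    then show ?thesis using that(1) by (metis mult_le_cancel_left_pos zero_less_power)
  qed
  have mono: "x * y^2 \<le> z^3" "x^2 * y \<le> z^3" "x^3 \<le> z^3" "y^3 \<le> z^3" "x * y^2 \<ge> 0" "x^2 * y \<ge> 0" "x^3 \<ge> 0" "y^3 \<ge> 0"
    if "0 \<le> x" "x \<le> z" "0 \<le> y" "y \<le> z" for x y z :: int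
    using that by (auto simp: power2_eq_square power3_eq_cube mult.assoc intro!: mult_mono)
  show ?thesis
  proof (cases "M \<le> N")
    case True
    note m = mono[OF MN(1) True less_imp_le[OF MN(2)] order_refl]
    have "N^4 \<le> 11394122 * (F + G)"
      by (rule cancel[OF MN(2) _ bz(1)]) (use m in linarith)+
    then show ?thesis using True by simp
  next
    case False
    then have M: "M > 0" "N \<le> M" using MN by simp_all
    note m = mono[OF MN(1) order_refl less_imp_le[OF MN(2)] M(2)]
    have "M^4 \<le> 11394122 * (F + G)"
      by (rule cancel[OF M(1) _ bz(2)]) (use m in linarith)+
    then show ?thesis using M(2) by simp
  qed
qed

text \<open>Common divisors of the two forms divide constant multiples of N^7 and of M^7; 47941632 =
  2048 * 153^2 serves for both.\<close>

lemma doubling_gcd: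
  fixes M N g :: int
  assumes "coprime M N" "g dvd 4 * M * N * (153 * M^2 - 10 * M * N + N^2)" "g dvd (N^2 - 153 * M^2)^2"
  shows "g dvd 47941632"
proof -
  have "g dvd 2048 * N^7" unfolding doubling_bezout(1)[of N M]
    by (rule dvd_add[OF dvd_mult2[OF assms(2)] dvd_mult2[OF assms(3)]])
  then have "g dvd 23409 * (2048 * N^7)" by (rule dvd_mult)
  then have "g dvd 47941632 * N^7" by simp
  moreover have "g dvd 47941632 * M^7" unfolding doubling_bezout(2)[of M N]
    by (rule dvd_add[OF dvd_mult2[OF assms(2)] dvd_mult2[OF assms(3)]])
  ultimately have "g dvd gcd (47941632 * M^7) (47941632 * N^7)" by simp
  then show ?thesis using assms(1) by (simp add: gcd_mult_distrib_int[symmetric])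
qed

text \<open>A / B below is the z-coordinate of a double before reduction, and N / D is any fraction
  equal to it. Cancellation is limited because the square of the gcd divides 47941632, while A^2 +
  B^2 is at least of order max^8. The constant is 2 * 11394122 * 47941632.\<close>

lemma doubling_height:
  fixes a b n N D L :: int
  assumes "b > 0" "coprime a b" and n: "n^2 = 153 * a^4 - 10 * a^2 * b^2 + b^4"
    and eq: "(2 * a * b * n) * D = N * (b^4 - 153 * a^4)" and "D \<noteq> 0" "b^4 - 153 * a^4 \<noteq> 0"
    and L: "\<bar>N\<bar> \<le> L" "\<bar>D\<bar> \<le> L"
  shows "max \<bar>a\<bar> b ^ 8 \<le> 1092505607774208 * L^2"
proof -
  define A where "A = 2 * a * b * n"
  define B where "B = b^4 - 153 * a^4"
  have A2: "A^2 = 4 * a^2 * b^2 * (153 * (a^2)^2 - 10 * a^2 * b^2 + (b^2)^2)"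
    using n unfolding A_def by algebra
  have B2: "B^2 = ((b^2)^2 - 153 * (a^2)^2)^2" unfolding B_def by algebra
  have AB: "A * D = N * B" "B \<noteq> 0" using assms by (simp_all add: A_def B_def)
  obtain g A1 B1 where g: "A = A1 * g" "B = B1 * g" "coprime A1 B1"
    using gcd_coprime_exists[of A B] AB(2) by (metis gcd_eq_0_iff)
  have g0: "g \<noteq> 0" "B1 \<noteq> 0" using AB(2) g by auto
  have "A1 * D = N * B1" using AB(1) g g0 by (simp add: mult.assoc mult.left_commute)
  then have "B1 dvd A1 * D" by simp
  then have "B1 dvd D" using g(3) by (simp add: coprime_commute coprime_dvd_mult_right_iff)
  then obtain k where k: "D = B1 * k" ..
  then have "N = A1 * k" using \<open>A1 * D = N * B1\<close> g0 by (simp add: mult_ac)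
  have "\<bar>k\<bar> \<ge> 1" using k assms(5) by auto
  then have "\<bar>A1\<bar> * 1 \<le> \<bar>A1\<bar> * \<bar>k\<bar>" "\<bar>B1\<bar> * 1 \<le> \<bar>B1\<bar> * \<bar>k\<bar>" by (intro mult_left_mono; simp)+
  then have "\<bar>A1\<bar> \<le> L" "\<bar>B1\<bar> \<le> L" using L k \<open>N = A1 * k\<close> by (auto simp: abs_mult)
  then have A1B1: "A1^2 + B1^2 \<le> 2 * L^2"
    using abs_le_square_iff[of A1 L] abs_le_square_iff[of B1 L] L by simp
  have "g^2 dvd A^2" "g^2 dvd B^2" using g by (auto simp: power_mult_distrib)
  then have "g^2 dvd 47941632"
    using assms(2) unfolding A2 B2 by (intro doubling_gcd[of "a^2" "b^2"]) auto
  then have gK: "g^2 \<le> 47941632" by (intro zdvd_imp_le) auto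
  have "max (a^2) (b^2) ^ 4 \<le> 11394122 * (A^2 + B^2)"
    using assms(1) by (intro doubling_lower_bound[OF _ _ A2 _ B2]) auto
  also have "A^2 + B^2 = g^2 * (A1^2 + B1^2)" unfolding g by algebra
  also have "11394122 * (g^2 * (A1^2 + B1^2)) \<le> 11394122 * (47941632 * (2 * L^2))"
    using gK A1B1 by (intro mult_left_mono mult_mono) auto
  also have "max (a^2) (b^2) = max \<bar>a\<bar> b ^ 2"
    using abs_le_square_iff[of a b] abs_le_square_iff[of b a] assms(1) by (auto simp: max_def)
  finally show ?thesis by (simp flip: power_mult)
qed

text \<open>Translation costs only a square of the height, against the fourth power gained by
  doubling. The constant is 54 = 3 (1 + 17), from the denominator 3 (e^2 - 17 m^2).\<close>

lemma jac_translate_height: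
  assumes "(z, y) \<in> jac" "R \<in> {(0, 1), (0, - 1), (- 1 / 3, 4 / 3), (1 / 3, - 4 / 3)}"
  shows "\<exists>N D :: int. D \<noteq> 0 \<and> fst (jadd R (z, y)) = of_int N / of_int D
    \<and> \<bar>N\<bar> \<le> 54 * jht (z, y)^2 \<and> \<bar>D\<bar> \<le> 54 * jht (z, y)^2"
proof -
  obtain m e n :: int where e: "e > 0" "coprime m e" "z = of_int m / of_int e" "y = of_int n / of_int e^2"
    and n: "n^2 = 153 * m^4 - 10 * m^2 * e^2 + e^4"
    using jac_cases[OF assms(1)] .
  define H where "H = jht (z, y)"
  have H: "H = max \<bar>m\<bar> e" using jht_eq[OF e(1-3)] by (simp add: H_def)
  have H1: "H \<ge> 1" "\<bar>m\<bar> \<le> H" "\<bar>e\<bar> \<le> H" using e(1) by (auto simp: H)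
  have sq: "m^2 \<le> H^2" "e^2 \<le> H^2" "\<bar>m * e\<bar> \<le> H^2"
    using H1 mult_mono[of "\<bar>m\<bar>" H "\<bar>e\<bar>" H] abs_le_square_iff[of m H] abs_le_square_iff[of e H]
    by (auto simp: abs_mult power2_eq_square)
  have HH: "H \<le> H^2" using H1 by (simp add: power2_eq_square)
  have "m^4 \<le> H^4" "e^4 \<le> H^4" using power_mono[OF H1(2), of 4] power_mono[OF H1(3), of 4] by auto
  moreover have "0 \<le> 10 * m^2 * e^2" "0 \<le> H^4" by simp_all
  \<comment> \<open>The middle term is nonpositive and 153 + 1 is at most 169 = 13^2.\<close>
  ultimately have "n^2 \<le> 169 * H^4" unfolding n by linarith
  also have "\<dots> = (13 * H^2)^2" by (simp add: power_mult_distrib flip: power_mult)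
  finally have nH: "\<bar>n\<bar> \<le> 13 * H^2" using abs_le_square_iff[of n "13 * H^2"] by simp
  have zy: "(of_int m / of_int e :: rat) = of_int m * of_int e / of_int e^2" using e(1) by (simp add: power2_eq_square)
  have D: "1 - 17 * z^2 = of_int (e^2 - 17 * m^2) / of_int e^2"
    using e(1) by (simp add: e(3) power_divide diff_divide_distrib)
  have den: "e^2 - 17 * m^2 \<noteq> 0"
  proof
    assume "e^2 - 17 * m^2 = 0"
    then show False using jadd_denominator[of "1 / 3" z] D by (simp add: power_divide)
  qed
  have bD: "\<bar>3 * (e^2 - 17 * m^2)\<bar> \<le> 54 * H^2"
    using sq(1,2) zero_le_power2[of m] zero_le_power2[of e] unfolding abs_le_iff right_diff_distrib by linarith
  have bN: "\<bar>4 * m * e - n\<bar> \<le> 54 * H^2" "\<bar>n - 4 * m * e\<bar> \<le> 54 * H^2"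
    using sq(3) nH zero_le_power2[of H] unfolding abs_le_iff mult.assoc by linarith+
  have t1: "fst (jadd (- 1 / 3, 4 / 3) (z, y)) = of_int (4 * m * e - n) / of_int (3 * (e^2 - 17 * m^2))"
  proof -
    have "fst (jadd (- 1 / 3, 4 / 3) (z, y)) = ((4 * z - y) / 3) / (1 - 17 * z^2)"
      by (simp add: jadd_def jadd_z_def power_divide diff_divide_distrib)
    also have "(4 * z - y) / 3 = of_int (4 * m * e - n) / of_int e^2 / 3"
      unfolding e(3,4) zy by (simp add: diff_divide_distrib)
    finally show ?thesis unfolding D using e(1) by simp
  qed
  have t2: "fst (jadd (1 / 3, - 4 / 3) (z, y)) = of_int (n - 4 * m * e) / of_int (3 * (e^2 - 17 * m^2))"
  proof -
    have "fst (jadd (1 / 3, - 4 / 3) (z, y)) = ((y - 4 * z) / 3) / (1 - 17 * z^2)"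
      by (simp add: jadd_def jadd_z_def power_divide diff_divide_distrib)
    also have "(y - 4 * z) / 3 = of_int (n - 4 * m * e) / of_int e^2 / 3"
      unfolding e(3,4) zy by (simp add: diff_divide_distrib)
    finally show ?thesis unfolding D using e(1) by simp
  qed
  from assms(2) consider "R = (0, 1)" | "R = (0, - 1)" | "R = (- 1 / 3, 4 / 3)" | "R = (1 / 3, - 4 / 3)" by blast
  then show ?thesis
  proof cases
    case 1
    then show ?thesis using H1 HH e(1) e(3)[symmetric] unfolding H_def[symmetric] by - (rule exI[of _ m], rule exI[of _ e], auto)
  next
    case 2
    then show ?thesis using H1 HH e(1) e(3)[symmetric] unfolding H_def[symmetric] by - (rule exI[of _ "- m"], rule exI[of _ e], auto simp: jadd_T)
  next
    case 3
    show ?thesis unfolding 3 t1 H_def[symmetric] using den bD bN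
      by - (rule exI[of _ "4 * m * e - n"], rule exI[of _ "3 * (e^2 - 17 * m^2)"], simp)
  next
    case 4
    show ?thesis unfolding 4 t2 H_def[symmetric] using den bD bN
      by - (rule exI[of _ "n - 4 * m * e"], rule exI[of _ "3 * (e^2 - 17 * m^2)"], simp)
  qed
qed

text \<open>Translation and doubling combine to H'^8 \<le> K H^4. If H' exceeded H, then H'^4 \<le>
  K would follow and hence H' \<le> K, so any crude constant K does.\<close>

lemma jac_halve_height:
  assumes p: "p \<in> jac" "p' \<in> jac" and R: "R \<in> {(0, 1), (0, - 1), (- 1 / 3, 4 / 3), (1 / 3, - 4 / 3)}"
    and eq: "jadd R p = jadd p' p'"
  shows "jht p' \<le> max (jht p) (1092505607774208 * 54^2)"
proof -
  obtain z y x w where zy: "p = (z, y)" "p' = (x, w)" by (cases p, cases p')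
  obtain N D :: int where ND: "D \<noteq> 0" "fst (jadd R p) = of_int N / of_int D"
      "\<bar>N\<bar> \<le> 54 * jht p^2" "\<bar>D\<bar> \<le> 54 * jht p^2"
    using jac_translate_height[of z y R] p R zy by auto
  obtain a b n :: int where b: "b > 0" "coprime a b" "x = of_int a / of_int b" "w = of_int n / of_int b^2"
    and n: "n^2 = 153 * a^4 - 10 * a^2 * b^2 + b^4"
    using jac_cases[OF p(2)[unfolded zy(2)]] .
  have h': "jht p' = max \<bar>a\<bar> b" using jht_eq[OF b(1-3)] zy(2) by simp
  have den: "1 - 153 * x^2 * x^2 = of_int (b^4 - 153 * a^4) / of_int b^4"
    using b(1) by (simp add: b(3) power_divide diff_divide_distrib power4_eq_xxxx power2_eq_square)
  have B: "b^4 - 153 * a^4 \<noteq> 0"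
  proof
    assume "b^4 - 153 * a^4 = 0"
    then show False using jadd_denominator[of x x] unfolding den by simp
  qed
  have "fst (jadd p' p') = (2 * x * w) / (1 - 153 * x^2 * x^2)"
    by (simp add: zy jadd_def jadd_z_def)
  also have "2 * x * w = of_int (2 * a * b * n) / of_int b^4"
    using b(1) by (simp add: b(3,4) power4_eq_xxxx power2_eq_square)
  finally have "of_int N / of_int D = (of_int (2 * a * b * n) / of_int (b^4 - 153 * a^4) :: rat)"
    using ND(2) eq b(1) unfolding den by simp
  then have "(of_int (2 * a * b * n * D) :: rat) = of_int (N * (b^4 - 153 * a^4))"
    using ND(1) B by (simp only: of_int_mult) (simp add: frac_eq_eq del: of_int_diff)
  then have "(2 * a * b * n) * D = N * (b^4 - 153 * a^4)" unfolding of_int_eq_iff .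
  then have "jht p' ^ 8 \<le> 1092505607774208 * (54 * jht p^2)^2"
    unfolding h' using doubling_height[OF b(1,2) n _ ND(1) B ND(3,4)] by simp
  then have bound: "jht p' ^ 8 \<le> 1092505607774208 * 54^2 * jht p ^ 4"
    by (simp add: power_mult_distrib flip: power_mult)
  show ?thesis
  proof (rule ccontr)
    assume "\<not> ?thesis"
    then have lt: "jht p < jht p'" "jht p' > 1092505607774208 * 54^2" by auto
    have "jht p \<ge> 0" by (simp add: jht_def le_max_iff_disj)
    then have "jht p ^ 4 \<le> jht p' ^ 4" using lt(1) by (intro power_mono) auto
    then have "jht p' ^ 4 * jht p' ^ 4 \<le> (1092505607774208 * 54^2) * jht p' ^ 4"
      using bound by (simp flip: power_add)
    moreover have "0 < jht p' ^ 4" using lt(2) by simp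
    ultimately have "jht p' ^ 4 \<le> 1092505607774208 * 54^2" by (rule mult_right_le_imp_le)
    moreover have "jht p' \<le> jht p' ^ 4" using lt(2) by (intro self_le_power) auto
    ultimately show False using lt(2) by simp
  qed
qed

lemma jac_commensurable:
  assumes "P \<in> jac"
  shows "\<exists>(N::int) m::int. N \<noteq> 0 \<and> P [^]\<^bsub>jac_group\<^esub> N = (1 / 3, 4 / 3) [^]\<^bsub>jac_group\<^esub> m"
proof -
  interpret comm_group jac_group by (rule comm_group_jac_group)
  have g: "(1 / 3, 4 / 3) \<in> jac" and T: "(0, - 1) \<in> jac" by (simp_all add: jac_def power_divide)
  have gT: "jadd (1 / 3, 4 / 3) (0, - 1) = (- 1 / 3, - 4 / 3)"
    using jadd_T[of "(1 / 3, 4 / 3)"] by (simp add: jadd_commute)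
  show ?thesis
  proof (rule descent_imp_commensurable[where T = "(0, - 1)" and h = jht])
    show "finite {P \<in> carrier jac_group. jht P \<le> B}" for B using finite_jht_le by simp
    show "\<exists>P'\<in>carrier jac_group. \<exists>R\<in>{\<one>\<^bsub>jac_group\<^esub>, (0, - 1), (1 / 3, 4 / 3), (1 / 3, 4 / 3) \<otimes>\<^bsub>jac_group\<^esub> (0, - 1)}.
        P = R \<otimes>\<^bsub>jac_group\<^esub> (P' \<otimes>\<^bsub>jac_group\<^esub> P') \<and> jht P' \<le> max (jht P) (1092505607774208 * 54^2)"
      if "P \<in> carrier jac_group" for P
    proof -
      have P: "P \<in> jac" using that by simp
      obtain R p' where R: "R \<in> {(0, 1), (0, - 1), (- 1 / 3, 4 / 3), (1 / 3, - 4 / 3)}"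
        and p': "p' \<in> jac" "jadd R P = jadd p' p'" using jac_coset[OF P] by blast
      have Rj: "R \<in> jac" using R by (auto simp: jac_def power_divide)
      have "P = jadd (jneg R) (jadd R P)"
        using jadd_assoc[OF jneg_closed[OF Rj] Rj P] jadd_jneg[OF Rj] by simp
      then have "P = jadd (jneg R) (jadd p' p')" using p'(2) by simp
      \<comment> \<open>Moving R to the other side negates it, which turns the representatives of
        \<open>jac_coset\<close> into those expected by the descent.\<close>
      moreover have "jneg R \<in> {(0, 1), (0, - 1), (1 / 3, 4 / 3), jadd (1 / 3, 4 / 3) (0, - 1)}"
        unfolding gT using R by (auto simp: jneg_def)
      moreover have "jht p' \<le> max (jht P) (1092505607774208 * 54^2)"
        by (rule jac_halve_height[OF P p'(1) R p'(2)])
      ultimately show ?thesis using p'(1) by auto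
    qed
  qed (use g T assms in \<open>auto simp: jadd_T\<close>)
qed

subsection \<open>A point of infinite order\<close>

text \<open>The 2-adic valuation is k, expressed without division by a fraction that need not be
  reduced. The relation holds for no k at z = 0.\<close>

definition val2 :: "nat \<Rightarrow> rat \<Rightarrow> bool" where
  "val2 k z \<longleftrightarrow> (\<exists>a b :: int. odd a \<and> odd b \<and> z * of_int b = 2^k * of_int a)"

lemma val2_unique:
  assumes "val2 k z" "val2 l z"
  shows "k = l"
proof -
  have "\<not> k < l" if kl: "val2 k z" "val2 l z" for k l
  proof
    assume "k < l"
    then obtain i where i: "l = Suc (k + i)" using less_natE by blast
    obtain a b a' b' :: int where ab: "odd a" "odd b" "odd a'" "odd b'"
      "z * of_int b = 2^k * of_int a" "z * of_int b' = 2^l * of_int a'"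
      using kl unfolding val2_def by blast
    have "2^k * of_int a * of_int b' = 2^l * of_int a' * (of_int b :: rat)"
      using ab(5,6) by (metis mult.assoc mult.commute)
    then have "(of_int (a * b') :: rat) = of_int (2 * 2^i * a' * b)"
      by (simp add: i power_add mult_ac)
    then have "a * b' = 2 * 2^i * a' * b" unfolding of_int_eq_iff .
    then show False using ab(1,4) by (metis even_mult_iff dvd_triv_left mult.assoc)
  qed
  then show ?thesis using assms by (metis linorder_neqE_nat)
qed

text \<open>The double has z = 2 m e n / (e^4 - 153 m^4). Positive valuation means m even, so e, n
  and the denominator are odd and exactly one factor 2 is gained; for odd m and e the denominator
  would be even, hence the \<open>Suc k\<close>.\<close>

lemma val2_double:
  assumes p: "p \<in> jac" and v: "val2 (Suc k) (fst p)"
  shows "val2 (Suc (Suc k)) (fst (jadd p p))"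
proof -
  obtain z y where zy: "p = (z, y)" by (cases p)
  obtain m e n :: int where e: "e > 0" "coprime m e" "z = of_int m / of_int e" "y = of_int n / of_int e^2"
    and n: "n^2 = 153 * m^4 - 10 * m^2 * e^2 + e^4"
    using jac_cases[OF p[unfolded zy]] .
  obtain a b :: int where ab: "odd a" "odd b" "z * of_int b = 2^Suc k * of_int a"
    using v zy unfolding val2_def by auto
  then have "(of_int (m * b) :: rat) = of_int (2^Suc k * a * e)" using e(1) by (simp add: e(3) field_simps)
  then have mb: "m * b = 2^Suc k * a * e" unfolding of_int_eq_iff .
  then have "even (m * b)" by simp
  then have "even m" using ab(2) by simp
  then have "odd e" using e(2) by (metis coprime_common_divisor odd_one)
  have "odd (n^2)" using \<open>even m\<close> \<open>odd e\<close> unfolding n by simp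
  then have "odd n" by simp
  have den: "1 - 153 * z^2 * z^2 = of_int (e^4 - 153 * m^4) / of_int e^4"
    using e(1) by (simp add: e(3) power_divide diff_divide_distrib power4_eq_xxxx power2_eq_square)
  have B: "e^4 - 153 * m^4 \<noteq> 0"
  proof
    assume "e^4 - 153 * m^4 = 0"
    then show False using jadd_denominator[of z z] unfolding den by simp
  qed
  have "fst (jadd p p) = (2 * z * y) / (1 - 153 * z^2 * z^2)"
    by (simp add: zy jadd_def jadd_z_def)
  also have "2 * z * y = of_int (2 * m * e * n) / of_int e^4"
    using e(1) by (simp add: e(3,4) power4_eq_xxxx power2_eq_square)
  finally have "fst (jadd p p) = of_int (2 * m * e * n) / of_int (e^4 - 153 * m^4)"
    using e(1) unfolding den by simp
  then have "fst (jadd p p) * of_int (e^4 - 153 * m^4) = of_int (2 * m * e * n)" using B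
    by (metis nonzero_eq_divide_eq of_int_eq_0_iff)
  then have "fst (jadd p p) * of_int (b * (e^4 - 153 * m^4)) = of_int (2 * e * n * (m * b))"
    by (simp add: mult_ac)
  also have "2 * e * n * (m * b) = 2^Suc (Suc k) * (a * e^2 * n)"
    unfolding mb by (simp add: power2_eq_square)
  finally have "fst (jadd p p) * of_int (b * (e^4 - 153 * m^4)) = 2^Suc (Suc k) * of_int (a * e^2 * n)"
    by simp
  moreover have "odd (b * (e^4 - 153 * m^4))" "odd (a * e^2 * n)"
    using ab \<open>odd e\<close> \<open>odd n\<close> \<open>even m\<close> by simp_all
  ultimately show ?thesis unfolding val2_def by blast
qed

lemma jac_infinite_order:
  assumes "p \<in> jac" "val2 (Suc k) (fst p)" "p [^]\<^bsub>jac_group\<^esub> (n::int) = (0, 1)"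
  shows "n = 0"
proof (rule ccontr)
  assume "n \<noteq> 0"
  interpret comm_group jac_group by (rule comm_group_jac_group)
  have p: "p \<in> carrier jac_group" using assms(1) by simp
  let ?f = "\<lambda>i::nat. p [^]\<^bsub>jac_group\<^esub> (2^i :: int)"
  have v: "val2 (Suc (k + i)) (fst (?f i))" for i
  proof (induction i)
    case 0
    then show ?case using assms(2) p by simp
  next
    case (Suc i)
    have "jadd (?f i) (?f i) = ?f (Suc i)"
      using int_pow_mult[OF p, of "2^i" "2^i"] by simp
    moreover have "?f i \<in> jac" using int_pow_closed[OF p] by simp
    ultimately show ?case using val2_double Suc.IH by fastforce
  qed
  have "inj ?f"
  proof
    fix i j assume "?f i = ?f j"
    then have "Suc (k + i) = Suc (k + j)" using v val2_unique by metis
    then show "i = j" by simp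
  qed
  moreover have "finite (range ?f)"
  proof (rule finite_subset)
    \<comment> \<open>The sign of a residue follows that of n, hence the symmetric interval.\<close>
    show "range ?f \<subseteq> (\<lambda>i::int. p [^]\<^bsub>jac_group\<^esub> i) ` {- \<bar>n\<bar>..\<bar>n\<bar>}"
    proof (rule image_subsetI)
      fix i :: nat
      let ?j = "2^i :: int"
      have "p [^]\<^bsub>jac_group\<^esub> (n * (?j div n)) = \<one>\<^bsub>jac_group\<^esub>"
        using int_pow_pow[OF p, of n "?j div n"] assms(3) int_pow_one by simp
      then have "p [^]\<^bsub>jac_group\<^esub> (n * (?j div n) + ?j mod n) = p [^]\<^bsub>jac_group\<^esub> (?j mod n)"
        using int_pow_mult[OF p] int_pow_closed[OF p] by (metis l_one)
      then have "?f i = p [^]\<^bsub>jac_group\<^esub> (?j mod n)" by simp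
      moreover have "?j mod n \<in> {- \<bar>n\<bar>..\<bar>n\<bar>}"
        using abs_mod_less[OF \<open>n \<noteq> 0\<close>, of ?j] by auto
      ultimately show "?f i \<in> (\<lambda>i::int. p [^]\<^bsub>jac_group\<^esub> i) ` {- \<bar>n\<bar>..\<bar>n\<bar>}" by blast
    qed
  qed simp
  ultimately show False using finite_imageD by blast
qed

text \<open>The point is -6 g. Since z has the values 1/3, -1, -1/6, 3/19, 35/39 and -44/127 at g,
  ..., 6 g, this is, up to sign, the first multiple of g with positive valuation.\<close>

lemma jac_witness: "(44 / 127, 22833 / 16129) \<in> jac" "val2 2 (44 / 127)"
proof -
  show "(44 / 127, 22833 / 16129) \<in> jac" by (simp add: jac_def power_divide)
  have "(44 / 127 :: rat) * of_int 127 = 2^2 * of_int 11" by simp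
  moreover have "odd (11::int)" "odd (127::int)" by simp_all
  ultimately show "val2 2 (44 / 127)" unfolding val2_def by blast
qed

subsection \<open>Line sections of the cubic\<close>

(* The linear change of coordinates from (X : Y : W) on the Weierstrass model to (a : b : c). *)
definition wpt :: "rat \<Rightarrow> rat \<Rightarrow> rat \<Rightarrow> rat ^ 3" where
  "wpt X Y W = vector [8 * W - X + Y, 8 * W - X - Y, 4 * X - 8 * W]"

definition weier :: "rat \<Rightarrow> rat \<Rightarrow> rat \<Rightarrow> rat" where
  "weier X Y W = Y^2 * W - X^3 - 5 * X^2 * W + 32 * X * W^2"

lemma cubic_at_wpt: "cubic_at (wpt X Y W) = 24 * weier X Y W"
  unfolding cubic_at_def wpt_def cubic_def weier_def vector_3 by algebra

lemma wpt_linear: "s *s wpt X Y W + t *s wpt X' Y' W' = wpt (s * X + t * X') (s * Y + t * Y') (s * W + t * W')"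
  by (simp add: vec_eq_iff forall_3 wpt_def algebra_simps)

lemma wpt_scale: "s *s wpt X Y W = wpt (s * X) (s * Y) (s * W)"
  by (simp add: vec_eq_iff forall_3 wpt_def algebra_simps)

lemma wpt_eq_iff: "wpt X Y W = wpt X' Y' W' \<longleftrightarrow> X = X' \<and> Y = Y' \<and> W = W'"
proof
  assume "wpt X Y W = wpt X' Y' W'"
  then have "8 * W - X + Y = 8 * W' - X' + Y'" "8 * W - X - Y = 8 * W' - X' - Y'" "4 * X - 8 * W = 4 * X' - 8 * W'"
    by (simp_all add: vec_eq_iff forall_3 wpt_def)
  then show "X = X' \<and> Y = Y' \<and> W = W'" by linarith
qed simp

lemma wpt_zero: "wpt 0 0 0 = 0"
  by (simp add: vec_eq_iff forall_3 wpt_def)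

lemma wpt_eq_0_iff: "wpt X Y W = 0 \<longleftrightarrow> X = 0 \<and> Y = 0 \<and> W = 0"
  using wpt_eq_iff[of X Y W 0 0 0] by (simp add: wpt_zero)

lemma wpt_cases: obtains X Y W where "v = wpt X Y W"
proof
  define W where "W = (v $ 3 + 2 * (v $ 1 + v $ 2)) / 24"
  show "v = wpt (v $ 3 / 4 + 2 * W) ((v $ 1 - v $ 2) / 2) W"
    by (simp add: vec_eq_iff forall_3 wpt_def W_def field_simps)
qed

lemma mem_proj: "v \<in> proj v"
  unfolding proj_def by (auto intro: exI[of _ 1])

lemma proj_scale:
  assumes "c \<noteq> 0"
  shows "proj (c *s v) = proj v"
  unfolding proj_def
proof (rule Set.set_eqI, rule iffI)
  fix x assume "x \<in> {k *s v |k. k \<noteq> 0}"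
  then obtain k where "x = k *s v" "k \<noteq> 0" by blast
  then have "x = (k / c) *s (c *s v)" "k / c \<noteq> 0" using assms by simp_all
  then show "x \<in> {k *s (c *s v) |k. k \<noteq> 0}" by blast
next
  fix x assume "x \<in> {k *s (c *s v) |k. k \<noteq> 0}"
  then obtain k where "x = k *s (c *s v)" "k \<noteq> 0" by blast
  then have "x = (k * c) *s v" "k * c \<noteq> 0" using assms by simp_all
  then show "x \<in> {k *s v |k. k \<noteq> 0}" by blast
qed

lemma proj_eqD: "proj v = proj w \<Longrightarrow> \<exists>k. k \<noteq> 0 \<and> v = k *s w"
  using mem_proj[of v] unfolding proj_def by auto

lemma independent_pairI:
  fixes u v :: "rat ^ 3"
  assumes "\<And>a b. a *s u + b *s v = 0 \<Longrightarrow> a = 0 \<and> b = 0"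
  shows "u \<noteq> v \<and> vec.independent {u, v}"
proof -
  have "u \<noteq> v" using assms[of 1 "- 1"] by auto
  moreover have "v \<noteq> 0" using assms[of 0 1] by auto
  moreover have "u \<notin> vec.span {v}"
  proof
    assume "u \<in> vec.span {v}"
    then obtain k where "u = k *s v" by (auto simp: vec.span_singleton)
    then show False using assms[of 1 "- k"] by (simp flip: vec.scale_left_distrib)
  qed
  ultimately show ?thesis by (simp add: vec.independent_insert)
qed

lemma independent_pairD:
  fixes u v :: "rat ^ 3"
  assumes "u \<noteq> v" "vec.independent {u, v}" "a *s u + b *s v = 0"
  shows "a = 0 \<and> b = 0"
proof -
  have uv: "u \<notin> vec.span {v}" "v \<noteq> 0" using assms(1,2) by (auto simp: vec.independent_insert)
  have "a = 0"
  proof (rule ccontr)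
    assume "a \<noteq> 0"
    have "a *s u = (- b) *s v" using assms(3) by (simp add: eq_neg_iff_add_eq_0)
    then have "(1 / a) *s (a *s u) = (1 / a) *s ((- b) *s v)" by simp
    then have "u = (- b / a) *s v" using \<open>a \<noteq> 0\<close> by simp
    then show False using uv(1) unfolding vec.span_singleton by (metis rangeI)
  qed
  then show ?thesis using assms(3) uv(2) by simp
qed

lemma line_section_cases:
  assumes "line_section P Q R"
  obtains u v s1 t1 s2 t2 s3 t3 k where "u \<noteq> v" "vec.independent {u, v}" "k \<noteq> 0"
    "P = proj (s1 *s u + t1 *s v)" "Q = proj (s2 *s u + t2 *s v)" "R = proj (s3 *s u + t3 *s v)"
    "\<And>s t. cubic_at (s *s u + t *s v) = k * (s * t1 - t * s1) * (s * t2 - t * s2) * (s * t3 - t * s3)"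
  using assms unfolding line_section_def by (elim exE conjE) metis

lemma line_section_parametrized:
  assumes "u \<noteq> v \<and> vec.independent {u, v}" "k \<noteq> 0"
    "P = proj (s1 *s u + t1 *s v)" "Q = proj (s2 *s u + t2 *s v)" "R = proj (s3 *s u + t3 *s v)"
    "\<And>s t. cubic_at (s *s u + t *s v) = k * (s * t1 - t * s1) * (s * t2 - t * s2) * (s * t3 - t * s3)"
  shows "line_section P Q R"
  unfolding line_section_def
  by (rule exI[of _ u], rule exI[of _ v], rule exI[of _ s1], rule exI[of _ t1], rule exI[of _ s2],
      rule exI[of _ t2], rule exI[of _ s3], rule exI[of _ t3], rule exI[of _ k])
    (use assms in \<open>simp only: simp_thms\<close>)

lemma line_sectionI:
  assumes ind: "\<And>a b. a * X + b * X' = 0 \<Longrightarrow> a * Y + b * Y' = 0 \<Longrightarrow> a * W + b * W' = 0 \<Longrightarrow> a = 0 \<and> b = 0"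
    and "k \<noteq> 0"
    and "P = proj (wpt (s1 * X + t1 * X') (s1 * Y + t1 * Y') (s1 * W + t1 * W'))"
    and "Q = proj (wpt (s2 * X + t2 * X') (s2 * Y + t2 * Y') (s2 * W + t2 * W'))"
    and "R = proj (wpt (s3 * X + t3 * X') (s3 * Y + t3 * Y') (s3 * W + t3 * W'))"
    and form: "\<And>s t. weier (s * X + t * X') (s * Y + t * Y') (s * W + t * W')
      = k * (s * t1 - t * s1) * (s * t2 - t * s2) * (s * t3 - t * s3)"
  shows "line_section P Q R"
proof (rule line_section_parametrized[of "wpt X Y W" "wpt X' Y' W'" "24 * k" P s1 t1 Q s2 t2 R s3 t3])
  show "wpt X Y W \<noteq> wpt X' Y' W' \<and> vec.independent {wpt X Y W, wpt X' Y' W'}"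
  proof (rule independent_pairI)
    fix a b assume "a *s wpt X Y W + b *s wpt X' Y' W' = 0"
    then show "a = 0 \<and> b = 0" using ind[of a b] unfolding wpt_linear wpt_eq_0_iff by blast
  qed
qed (use assms(2-5) in \<open>simp_all add: wpt_linear cubic_at_wpt form\<close>)

lemma line_section_swap12:
  assumes "line_section P Q R"
  shows "line_section Q P R"
proof -
  obtain u v s1 t1 s2 t2 s3 t3 k where 1: "u \<noteq> v" "vec.independent {u, v}" "k \<noteq> 0"
    "P = proj (s1 *s u + t1 *s v)" "Q = proj (s2 *s u + t2 *s v)" "R = proj (s3 *s u + t3 *s v)"
    and form: "\<And>s t. cubic_at (s *s u + t *s v) = k * (s * t1 - t * s1) * (s * t2 - t * s2) * (s * t3 - t * s3)"
    using line_section_cases[OF assms] by metis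
  show ?thesis
    by (rule line_section_parametrized[of u v k Q s2 t2 P s1 t1 R s3 t3])
      (use 1 in \<open>simp_all only: form mult_ac simp_thms\<close>)
qed

lemma line_section_swap23:
  assumes "line_section P Q R"
  shows "line_section P R Q"
proof -
  obtain u v s1 t1 s2 t2 s3 t3 k where 1: "u \<noteq> v" "vec.independent {u, v}" "k \<noteq> 0"
    "P = proj (s1 *s u + t1 *s v)" "Q = proj (s2 *s u + t2 *s v)" "R = proj (s3 *s u + t3 *s v)"
    and form: "\<And>s t. cubic_at (s *s u + t *s v) = k * (s * t1 - t * s1) * (s * t2 - t * s2) * (s * t3 - t * s3)"
    using line_section_cases[OF assms] by metis
  show ?thesis
    by (rule line_section_parametrized[of u v k P s1 t1 R s3 t3 Q s2 t2])
      (use 1 in \<open>simp_all only: form mult_ac simp_thms\<close>)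
qed

text \<open>Representatives of the first two points may be prescribed: rescaling their parameters is
  absorbed into k.\<close>

lemma line_section_normalize:
  assumes "line_section (proj v1) (proj v2) R" and v1: "v1 \<noteq> 0" "v2 \<noteq> 0"
  obtains u v s1 t1 s2 t2 s3 t3 k where "u \<noteq> v" "vec.independent {u, v}" "k \<noteq> 0"
    "v1 = s1 *s u + t1 *s v" "v2 = s2 *s u + t2 *s v" "R = proj (s3 *s u + t3 *s v)"
    "\<And>s t. cubic_at (s *s u + t *s v) = k * (s * t1 - t * s1) * (s * t2 - t * s2) * (s * t3 - t * s3)"
proof -
  obtain u v s1 t1 s2 t2 s3 t3 k where uv: "u \<noteq> v" "vec.independent {u, v}" "k \<noteq> 0"
    and P: "proj v1 = proj (s1 *s u + t1 *s v)" and Q: "proj v2 = proj (s2 *s u + t2 *s v)"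
    and R: "R = proj (s3 *s u + t3 *s v)"
    and form: "\<And>s t. cubic_at (s *s u + t *s v) = k * (s * t1 - t * s1) * (s * t2 - t * s2) * (s * t3 - t * s3)"
    using line_section_cases[OF assms(1)] by metis
  obtain a where a: "a \<noteq> 0" "v1 = a *s (s1 *s u + t1 *s v)" using proj_eqD[OF P] by blast
  obtain b where b: "b \<noteq> 0" "v2 = b *s (s2 *s u + t2 *s v)" using proj_eqD[OF Q] by blast
  show ?thesis
  proof (rule that[OF uv(1,2), of "k / (a * b)" "a * s1" "a * t1" "b * s2" "b * t2" s3 t3])
    show "cubic_at (s *s u + t *s v) = k / (a * b) * (s * (a * t1) - t * (a * s1)) * (s * (b * t2) - t * (b * s2))
        * (s * t3 - t * s3)" for s t
    proof -
      have "k / (a * b) * (s * (a * t1) - t * (a * s1)) * (s * (b * t2) - t * (b * s2)) * (s * t3 - t * s3)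
        = (k / (a * b)) * (a * b) * (s * t1 - t * s1) * (s * t2 - t * s2) * (s * t3 - t * s3)" by algebra
      then show ?thesis using form a(1) b(1) by simp
    qed
  qed (use uv a b R in \<open>simp_all add: vec.scale_right_distrib\<close>)
qed

text \<open>Distinct points span the line, so their representatives can replace the basis. Two roots
  of the form are then the coordinate points, and the third is (-b : a).\<close>

lemma line_section_residual:
  assumes "line_section (proj v1) (proj v2) R" and v: "v1 \<noteq> 0" "v2 \<noteq> 0" and ne: "proj v1 \<noteq> proj v2"
  obtains a b l where "l \<noteq> 0" "R = proj (a *s v2 - b *s v1)"
    "\<And>x y. cubic_at (x *s v1 + y *s v2) = l * x * y * (a * x + b * y)"
proof -
  obtain u w s1 t1 s2 t2 s3 t3 k where uv: "u \<noteq> w" "vec.independent {u, w}" "k \<noteq> 0"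
    and P: "v1 = s1 *s u + t1 *s w" and Q: "v2 = s2 *s u + t2 *s w" and R: "R = proj (s3 *s u + t3 *s w)"
    and form: "\<And>s t. cubic_at (s *s u + t *s w) = k * (s * t1 - t * s1) * (s * t2 - t * s2) * (s * t3 - t * s3)"
    using line_section_normalize[OF assms(1) v] by metis
  define \<Delta> where "\<Delta> = s1 * t2 - t1 * s2"
  define a where "a = s1 * t3 - t1 * s3"
  define b where "b = s2 * t3 - t2 * s3"
  have lin: "x *s v1 + y *s v2 = (x * s1 + y * s2) *s u + (x * t1 + y * t2) *s w" for x y
    unfolding P Q by (simp add: vec_eq_iff algebra_simps)
  have "\<Delta> \<noteq> 0"
  proof
    assume D: "\<Delta> = 0"
    have "s1 *s v2 = s2 *s v1" "t1 *s v2 = t2 *s v1"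
      using D unfolding \<Delta>_def P Q by (simp_all add: vec_eq_iff algebra_simps)
    moreover have "s1 \<noteq> 0 \<or> t1 \<noteq> 0" using v(1) P by auto
    ultimately obtain c d where cd: "c \<noteq> 0" "c *s v2 = d *s v1" by blast
    moreover from this have "d \<noteq> 0" using v by auto
    ultimately show False using ne proj_scale by metis
  qed
  show ?thesis
  proof (rule that[of "- k * \<Delta>^2" a b])
    show "- k * \<Delta>^2 \<noteq> 0" using uv(3) \<open>\<Delta> \<noteq> 0\<close> by simp
    have "a *s v2 - b *s v1 = \<Delta> *s (s3 *s u + t3 *s w)"
      unfolding P Q a_def b_def \<Delta>_def by (simp add: vec_eq_iff algebra_simps)
    then show "R = proj (a *s v2 - b *s v1)" using R proj_scale[OF \<open>\<Delta> \<noteq> 0\<close>] by simp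
    show "cubic_at (x *s v1 + y *s v2) = - k * \<Delta>^2 * x * y * (a * x + b * y)" for x y
      unfolding lin form a_def b_def \<Delta>_def by algebra
  qed
qed

lemma line_section_unique:
  assumes "line_section (proj v1) (proj v2) R" "line_section (proj v1) (proj v2) R'"
    and v: "v1 \<noteq> 0" "v2 \<noteq> 0" and ne: "proj v1 \<noteq> proj v2"
  shows "R = R'"
proof -
  obtain a b l where 1: "l \<noteq> 0" "R = proj (a *s v2 - b *s v1)"
    "\<And>x y. cubic_at (x *s v1 + y *s v2) = l * x * y * (a * x + b * y)"
    using line_section_residual[OF assms(1) v ne] by metis
  obtain a' b' l' where 2: "l' \<noteq> 0" "R' = proj (a' *s v2 - b' *s v1)"
    "\<And>x y. cubic_at (x *s v1 + y *s v2) = l' * x * y * (a' * x + b' * y)"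
    using line_section_residual[OF assms(2) v ne] by metis
  \<comment> \<open>The values at (1, 1) and (1, -1) determine the coefficients of x^2 y and x y^2,
    hence (a : b).\<close>
  have "l * (a + b) = l' * (a' + b')" using 1(3)[of 1 1] 2(3)[of 1 1] by simp
  moreover have "l * (a - b) = l' * (a' - b')" using 1(3)[of 1 "- 1"] 2(3)[of 1 "- 1"] by simp
  ultimately have ab: "l * a = l' * a'" "l * b = l' * b'" by (simp_all add: algebra_simps)
  have "R = proj (l *s (a *s v2 - b *s v1))" using 1 proj_scale by metis
  also have "l *s (a *s v2 - b *s v1) = l' *s (a' *s v2 - b' *s v1)"
    using ab by (simp add: vec.scale_right_diff_distrib)
  also have "proj \<dots> = R'" using 2 proj_scale by metis
  finally show ?thesis .
qed

section \<open>Absence of triple contact away from O\<close>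

lemma sq_mod_5: "(x::int)^2 mod 5 = 0 \<and> 5 dvd x \<or> x^2 mod 5 = 1 \<or> x^2 mod 5 = 4"
proof -
  have "x mod 5 = 0 \<or> x mod 5 = 1 \<or> x mod 5 = 2 \<or> x mod 5 = 3 \<or> x mod 5 = 4" by presburger
  moreover have "x^2 mod 5 = (x mod 5)^2 mod 5" by (simp add: power_mod)
  ultimately show ?thesis by auto
qed

text \<open>This is the 3-division polynomial of Y^2 = X^3 + 5 X^2 - 32 X. Modulo 5 its
  homogenization is a quadratic form in m^2 and e^2, and squares modulo 5 are only 0, 1 and 4, which
  leaves no zero with m and e coprime.\<close>

lemma three_division_no_root: "3 * (x::rat)^4 + 20 * x^3 - 192 * x^2 - 1024 \<noteq> 0"
proof
  assume eq: "3 * x^4 + 20 * x^3 - 192 * x^2 - 1024 = 0"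
  obtain m e :: int where e: "e > 0" "coprime m e" "x = of_int m / of_int e" by (rule rat_coprime_cases)
  have "3 * (x * of_int e)^4 + 20 * (x * of_int e)^3 * of_int e - 192 * (x * of_int e)^2 * of_int e^2 - 1024 * of_int e^4 = 0"
    using eq by algebra
  moreover have "x * of_int e = of_int m" using e by simp
  ultimately have "of_int (3 * m^4 + 20 * m^3 * e - 192 * m^2 * e^2 - 1024 * e^4) = (0::rat)" by simp
  then have "3 * m^4 + 20 * m^3 * e - 192 * m^2 * e^2 - 1024 * e^4 = 0" unfolding of_int_eq_0_iff .
  then have "3 * (m^2)^2 - 2 * m^2 * e^2 - 4 * (e^2)^2 = 5 * (38 * m^2 * e^2 + 204 * (e^2)^2 - 4 * m^3 * e)" by algebra
  then have "(3 * (m^2)^2 - 2 * m^2 * e^2 - 4 * (e^2)^2) mod 5 = 0" by simp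
  moreover have "(3 * A^2 - 2 * A * B - 4 * B^2) mod 5
      = (3 * (A mod 5)^2 - 2 * (A mod 5) * (B mod 5) - 4 * (B mod 5)^2) mod (5::int)" for A B
    by (intro mod_diff_cong mod_mult_cong) (simp_all add: power_mod)
  ultimately have "(3 * (m^2 mod 5)^2 - 2 * (m^2 mod 5) * (e^2 mod 5) - 4 * (e^2 mod 5)^2) mod 5 = 0" by metis
  then have "5 dvd m \<and> 5 dvd e" using sq_mod_5[of m] sq_mod_5[of e] by auto
  then show False using e(2) coprime_common_divisor[of m e 5] by simp
qed

(* The tangent at a flex would give a rational root of the 3-division polynomial. *)
lemma line_section_flex:
  assumes ls: "line_section (proj (wpt X Y 1)) (proj (wpt X Y 1)) (proj (wpt X Y 1))"
  shows False
proof -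
  define v1 where "v1 = wpt X Y 1"
  have v1: "v1 \<noteq> 0" by (simp add: v1_def wpt_eq_0_iff)
  obtain u w s1 t1 s2 t2 s3 t3 k where uw: "u \<noteq> w" "vec.independent {u, w}" "k \<noteq> 0"
    and P: "v1 = s1 *s u + t1 *s w" "v1 = s2 *s u + t2 *s w" and R: "proj v1 = proj (s3 *s u + t3 *s w)"
    and form: "\<And>s t. cubic_at (s *s u + t *s w) = k * (s * t1 - t * s1) * (s * t2 - t * s2) * (s * t3 - t * s3)"
    using line_section_normalize[OF ls[folded v1_def] v1 v1] by metis
  obtain c where c: "c \<noteq> 0" "s3 *s u + t3 *s w = c *s v1" using proj_eqD[OF R[symmetric]] by blast
  have "(s2 - s1) *s u + (t2 - t1) *s w = 0"
    using P by (simp add: vec_eq_iff algebra_simps)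
  then have 2: "s2 = s1" "t2 = t1" using independent_pairD[OF uw(1,2)] by fastforce+
  have "(s3 - c * s1) *s u + (t3 - c * t1) *s w = 0"
    using c(2) unfolding P(1) by (simp add: vec_eq_iff algebra_simps)
  then have 3: "s3 = c * s1" "t3 = c * t1" using independent_pairD[OF uw(1,2)] by fastforce+
  \<comment> \<open>Any direction other than that of \<open>v1\<close> will do: along it the cubic
    becomes a nonzero multiple of y^3.\<close>
  obtain a b where ab: "a * t1 - b * s1 \<noteq> 0"
  proof (cases "t1 = 0")
    case True
    then have "s1 \<noteq> 0" using v1 P by auto
    then show ?thesis using that[of 0 1] by simp
  next
    case False
    then show ?thesis using that[of 1 0] by simp
  qed
  define l where "l = k * c * (a * t1 - b * s1)^3"
  have l: "l \<noteq> 0" using uw(3) c(1) ab by (simp add: l_def)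
  have tangent: "cubic_at (x *s v1 + y *s (a *s u + b *s w)) = l * y^3" for x y
  proof -
    have lin: "x *s v1 + y *s (a *s u + b *s w) = (x * s1 + y * a) *s u + (x * t1 + y * b) *s w"
      unfolding P(1) by (simp add: vec_eq_iff algebra_simps)
    show ?thesis unfolding lin form 2 3 l_def by algebra
  qed
  obtain X' Y' W' where v2: "a *s u + b *s w = wpt X' Y' W'" by (rule wpt_cases)
  \<comment> \<open>Subtracting W' times \<open>v1\<close> moves the direction to W = 0. As l y^3
    does not involve x, the equation keeps its form.\<close>
  define \<alpha> where "\<alpha> = X' - W' * X"
  define \<beta> where "\<beta> = Y' - W' * Y"
  have g: "24 * weier (x * X + y * \<alpha>) (x * Y + y * \<beta>) x = l * y^3" for x y
    using tangent[of "x - y * W'" y] unfolding v2 v1_def wpt_linear cubic_at_wpt \<alpha>_def \<beta>_def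
    by (simp add: algebra_simps)
  have e0: "Y^2 = X^3 + 5 * X^2 - 32 * X" using g[of 1 0] by (simp add: weier_def)
  have e3: "- 24 * \<alpha>^3 = l" using g[of 0 1] by (simp add: weier_def)
  have p: "24 * ((Y + \<beta>)^2 - (X + \<alpha>)^3 - 5 * (X + \<alpha>)^2 + 32 * (X + \<alpha>)) = l"
    "24 * ((Y - \<beta>)^2 - (X - \<alpha>)^3 - 5 * (X - \<alpha>)^2 + 32 * (X - \<alpha>)) = - l"
    using g[of 1 1] g[of 1 "- 1"] by (simp_all add: weier_def)
  \<comment> \<open>Even and odd parts in y isolate the coefficients of x y^2 and x^2 y, both of
    which vanish under triple contact. Eliminating \<beta> from the two leaves the 3-division
    polynomial.\<close>
  have "48 * (\<beta>^2 - (3 * X + 5) * \<alpha>^2) =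
      24 * ((Y + \<beta>)^2 - (X + \<alpha>)^3 - 5 * (X + \<alpha>)^2 + 32 * (X + \<alpha>))
      + 24 * ((Y - \<beta>)^2 - (X - \<alpha>)^3 - 5 * (X - \<alpha>)^2 + 32 * (X - \<alpha>))
      - 48 * (Y^2 - (X^3 + 5 * X^2 - 32 * X))" by algebra
  then have e2: "\<beta>^2 = (3 * X + 5) * \<alpha>^2" unfolding p e0 by simp
  have "48 * (2 * Y * \<beta> - (3 * X^2 + 10 * X - 32) * \<alpha>) =
      24 * ((Y + \<beta>)^2 - (X + \<alpha>)^3 - 5 * (X + \<alpha>)^2 + 32 * (X + \<alpha>))
      - 24 * ((Y - \<beta>)^2 - (X - \<alpha>)^3 - 5 * (X - \<alpha>)^2 + 32 * (X - \<alpha>))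
      + 48 * \<alpha>^3" by algebra
  then have e1: "2 * Y * \<beta> = (3 * X^2 + 10 * X - 32) * \<alpha>" unfolding p using e3 by simp
  have \<alpha>: "\<alpha> \<noteq> 0" using e3 l by auto
  have "\<alpha>^2 * (3 * X^4 + 20 * X^3 - 192 * X^2 - 1024) = 0" using e0 e1 e2 by algebra
  then show False using \<alpha> three_division_no_root by simp
qed

subsection \<open>The cubic and the quartic\<close>

(* The general formula gives the zero vector at (0, 1). *)
definition jac_point :: "rat \<times> rat \<Rightarrow> proj_point" where
  "jac_point p = (if p = (0, 1) then proj (wpt 0 1 0)
     else proj (wpt (64 * fst p^2) (64 * fst p) (snd p - 1 + 5 * fst p^2)))"

lemma jac_point_zero: "jac_point (0, 1) = proj (wpt 0 1 0)"
  by (simp add: jac_point_def)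

lemma jac_point_neq: "(z, y) \<noteq> (0, 1) \<Longrightarrow> jac_point (z, y) = proj (wpt (64 * z^2) (64 * z) (y - 1 + 5 * z^2))"
  by (auto simp: jac_point_def)

lemma jac_eq: "(z, y) \<in> jac \<longleftrightarrow> y^2 = 153 * z^4 - 10 * z^2 + 1"
  by (simp add: jac_def)

lemma jac_third_neq_0:
  assumes "(z, y) \<in> jac" "(z, y) \<noteq> (0, 1)"
  shows "y - 1 + 5 * z^2 \<noteq> 0"
proof
  assume 0: "y - 1 + 5 * z^2 = 0"
  have "128 * z^4 = 0" using assms(1) 0 unfolding jac_eq by algebra
  then have "z = 0" by simp
  then show False using 0 assms(2) by simp
qed

lemma curve_O_wpt: "curve_O = proj (wpt 0 1 0)"
  by (simp add: curve_O_def wpt_def)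

lemma curve_points_wpt:
  "curve_points = {proj (wpt X Y W) | X Y W. \<not> (X = 0 \<and> Y = 0 \<and> W = 0) \<and> weier X Y W = 0}"
  unfolding curve_points_def
proof (rule Set.set_eqI, rule iffI)
  fix P assume "P \<in> {proj v |v. v \<noteq> 0 \<and> cubic_at v = 0}"
  then obtain v where v: "P = proj v" "v \<noteq> 0" "cubic_at v = 0" by blast
  obtain X Y W where "v = wpt X Y W" by (rule wpt_cases)
  then show "P \<in> {proj (wpt X Y W) | X Y W. \<not> (X = 0 \<and> Y = 0 \<and> W = 0) \<and> weier X Y W = 0}"
    using v by (auto simp: wpt_eq_0_iff cubic_at_wpt)
next
  fix P assume "P \<in> {proj (wpt X Y W) | X Y W. \<not> (X = 0 \<and> Y = 0 \<and> W = 0) \<and> weier X Y W = 0}"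
  then obtain X Y W where "P = proj (wpt X Y W)" "wpt X Y W \<noteq> 0" "cubic_at (wpt X Y W) = 0"
    by (auto simp: wpt_eq_0_iff cubic_at_wpt)
  then show "P \<in> {proj v |v. v \<noteq> 0 \<and> cubic_at v = 0}" by blast
qed

lemma jac_point_rep:
  assumes "p \<in> jac"
  obtains v where "jac_point p = proj v" "v \<noteq> 0"
proof -
  obtain z y where p: "p = (z, y)" by (cases p)
  show ?thesis
  proof (cases "p = (0, 1)")
    case True
    then show ?thesis using that[of "wpt 0 1 0"] by (simp add: jac_point_zero wpt_eq_0_iff)
  next
    case False
    then show ?thesis using that jac_third_neq_0 assms jac_point_neq[of z y] p by (metis wpt_eq_0_iff)
  qed
qed

lemma jac_point_closed:
  assumes "p \<in> jac"
  shows "jac_point p \<in> curve_points"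
proof -
  obtain z y where p: "p = (z, y)" by (cases p)
  show ?thesis
  proof (cases "p = (0, 1)")
    case True
    then show ?thesis unfolding curve_points_wpt by (force simp: jac_point_zero weier_def)
  next
    case False
    have "weier (64 * z^2) (64 * z) (y - 1 + 5 * z^2) = 0"
      using assms unfolding p jac_eq weier_def by algebra
    then show ?thesis unfolding curve_points_wpt
      using jac_point_neq[of z y] jac_third_neq_0[of z y] False assms p by auto
  qed
qed

lemma jac_point_inj:
  assumes "p \<in> jac" "q \<in> jac" "jac_point p = jac_point q"
  shows "p = q"
proof -
  have *: "jac_point (z, y) \<noteq> jac_point (0, 1)" if zy: "(z, y) \<in> jac" "(z, y) \<noteq> (0, 1)" for z y
  proof
    assume "jac_point (z, y) = jac_point (0, 1)"
    then obtain k where "wpt (64 * z^2) (64 * z) (y - 1 + 5 * z^2) = k *s wpt 0 1 0"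
      using proj_eqD unfolding jac_point_neq[OF zy(2)] jac_point_zero by blast
    then show False using jac_third_neq_0[OF zy] by (simp add: wpt_scale wpt_eq_iff)
  qed
  obtain z y z' y' where pq: "p = (z, y)" "q = (z', y')" by (cases p, cases q)
  show ?thesis
  proof (cases "p = (0, 1) \<or> q = (0, 1)")
    case True
    then show ?thesis using * assms pq by metis
  next
    case False
    then obtain k where k: "k \<noteq> 0" "wpt (64 * z^2) (64 * z) (y - 1 + 5 * z^2)
        = k *s wpt (64 * z'^2) (64 * z') (y' - 1 + 5 * z'^2)"
      using proj_eqD assms(3) jac_point_neq unfolding pq by metis
    note h = k(2)[unfolded wpt_scale wpt_eq_iff]
    have e: "z^2 = k * z'^2" "z = k * z'" "y - 1 + 5 * z^2 = k * (y' - 1 + 5 * z'^2)"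
      using h[THEN conjunct1] h[THEN conjunct2, THEN conjunct1] h[THEN conjunct2, THEN conjunct2] by simp_all
    show ?thesis
    proof (cases "z' = 0")
      case True
      then have "z = 0" using e by simp
      then have "y = - 1" "y' = - 1" using assms True False unfolding pq jac_eq by (auto simp: power2_eq_1_iff)
      then show ?thesis using True \<open>z = 0\<close> pq by simp
    next
      case False
      have "k * (k * z'^2) = k * z'^2" using e(1) unfolding e(2) by algebra
      then have "k = 1" using k(1) False by simp
      then show ?thesis using e pq by simp
    qed
  qed
qed

lemma jac_point_surj:
  assumes "P \<in> curve_points"
  shows "\<exists>p\<in>jac. P = jac_point p"
proof -
  obtain X Y W where P: "P = proj (wpt X Y W)" "\<not> (X = 0 \<and> Y = 0 \<and> W = 0)" "weier X Y W = 0"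
    using assms unfolding curve_points_wpt by blast
  show ?thesis
  proof (cases "W = 0")
    case True
    then have X: "X = 0" "Y \<noteq> 0" using P by (auto simp: weier_def)
    then have "P = proj (Y *s wpt 0 1 0)" using True P by (simp add: wpt_scale)
    then have "P = jac_point (0, 1)" using X proj_scale by (simp add: jac_point_zero)
    then show ?thesis by (intro bexI[of _ "(0, 1)"]) (simp_all add: jac_eq)
  next
    case W: False
    show ?thesis
    proof (cases "Y = 0")
      case True
      have "X = 0"
      proof (rule ccontr)
        assume "X \<noteq> 0"
        have "X^3 + 5 * X^2 * W - 32 * X * W^2 = 0" using P(3) unfolding True weier_def by simp
        then have "X * (X^2 + 5 * X * W - 32 * W^2) = 0" by algebra
        then have "X^2 + 5 * X * W - 32 * W^2 = 0" using \<open>X \<noteq> 0\<close> by simp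
        \<comment> \<open>The discriminant of X^2 + 5 X - 32 is not a square, so T is the only
          affine point with Y = 0.\<close>
        then have "(2 * X + 5 * W)^2 = 153 * W^2" by algebra
        then have "((2 * X + 5 * W) / W)^2 = 153" using W by (simp add: power_divide)
        then show False using sq_ne_153 by blast
      qed
      then have "P = proj ((- W / 2) *s wpt 0 0 (- 2))" using True P by (simp add: wpt_scale)
      then have "P = jac_point (0, - 1)"
        using proj_scale[of "- W / 2" "wpt 0 0 (- 2)"] W by (simp add: jac_point_neq)
      then show ?thesis by (intro bexI[of _ "(0, - 1)"]) (simp_all add: jac_eq)
    next
      case Y: False
      have X: "X \<noteq> 0" using P(3) W Y by (auto simp: weier_def)
      define z where "z = X / Y"
      \<comment> \<open>In affine terms this is 64 z^2 / X, the third coordinate y - 1 + 5 z^2 used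
        in \<open>jac_point\<close>.\<close>
      define w where "w = 64 * X * W / Y^2"
      define y where "y = w + 1 - 5 * z^2"
      have zY: "z * Y = X" "w * Y^2 = 64 * X * W" using Y by (simp_all add: z_def w_def)
      have "Y^4 * (w^2 + 2 * w * (1 - 5 * z^2) - 128 * z^4)
          = (w * Y^2)^2 + 2 * (w * Y^2) * (Y^2 - 5 * (z * Y)^2) - 128 * (z * Y)^4" by algebra
      also have "\<dots> = 0" using P(3) unfolding zY weier_def by algebra
      finally have "w^2 + 2 * w * (1 - 5 * z^2) - 128 * z^4 = 0" using Y by simp
      then have jac: "(z, y) \<in> jac" unfolding jac_eq y_def by algebra
      have "z \<noteq> 0" using X Y by (simp add: z_def)
      then have "jac_point (z, y) = proj (wpt (64 * z^2) (64 * z) w)"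
        using jac_point_neq[of z y] by (simp add: y_def)
      also have "wpt (64 * z^2) (64 * z) w = (64 * X / Y^2) *s wpt X Y W"
        using Y by (simp add: wpt_scale wpt_eq_iff z_def w_def power2_eq_square)
      also have "proj \<dots> = P" using P(1) X Y by (simp add: proj_scale)
      finally show ?thesis using jac by blast
    qed
  qed
qed

section \<open>Collinearity and the addition law\<close>

text \<open>Substituting y = 1 + b z + c z^2 into the quartic and dividing by z leaves a cubic with
  leading coefficient c^2 - 153, never zero. The hypotheses are its Vieta relations, and the
  conclusion says that the three points add up to zero.\<close>

lemma conic_vieta:
  fixes z1 z2 z3 b c :: rat
  assumes L: "(c^2 - 153) * (z1 + z2 + z3) = - 2 * b * c"
    "(c^2 - 153) * (z1 * z2 + z1 * z3 + z2 * z3) = b^2 + 2 * c + 10"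
    "(c^2 - 153) * (z1 * z2 * z3) = - 2 * b"
    and y: "y1 = 1 + b * z1 + c * z1^2" "y2 = 1 + b * z2 + c * z2^2"
  shows "jadd_z z1 y1 z2 y2 = - z3" "jadd_y z1 y1 z2 y2 = 1 + b * z3 + c * z3^2"
proof -
  have "c^2 - 153 \<noteq> 0" using sq_ne_153 by simp
  \<comment> \<open>The inverse is supplied as an equation so that the ideal membership argument can
    cancel the leading coefficient.\<close>
  then have i: "(c^2 - 153) * (1 / (c^2 - 153)) = 1" by simp
  have D: "1 - 153 * z1^2 * z2^2 \<noteq> 0" by (rule jadd_denominator)
  have "z3 * (1 - 153 * z1^2 * z2^2) = - (z1 * y2 + y1 * z2)"
    using L i unfolding y by algebra
  then have "z1 * y2 + y1 * z2 = (- z3) * (1 - 153 * z1^2 * z2^2)" by algebra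
  then show "jadd_z z1 y1 z2 y2 = - z3"
    unfolding jadd_z_def using D by simp
  have "(1 + 153 * z1^2 * z2^2) * (y1 * y2 - 10 * z1 * z2) + 306 * z1 * z2 * (z1^2 + z2^2)
      = (1 + b * z3 + c * z3^2) * (1 - 153 * z1^2 * z2^2)^2"
    using L i unfolding y by algebra
  then show "jadd_y z1 y1 z2 y2 = 1 + b * z3 + c * z3^2"
    unfolding jadd_y_def using D by simp
qed

text \<open>Negating z means negating Y, so a vertical line through the point also meets its
  negative and O.\<close>

lemma line_section_jac_neg:
  assumes "p \<in> jac"
  shows "line_section (jac_point p) (jac_point (jneg p)) (jac_point (0, 1))"
proof -
  obtain z y where p: "p = (z, y)" by (cases p)
  show ?thesis
  proof (cases "p = (0, 1)")
    case True
    \<comment> \<open>At O the line is the flex tangent W = 0, on which the form is -s^3.\<close>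
    have "line_section (jac_point (0, 1)) (jac_point (0, 1)) (jac_point (0, 1))"
      unfolding jac_point_zero
      by (rule line_sectionI[of 1 0 0 1 0 0 "- 1" _ 0 1 _ 0 1 _ 0 1]) (simp_all add: weier_def power3_eq_cube)
    then show ?thesis using True by (simp add: jneg_def)
  next
    case False
    define w where "w = y - 1 + 5 * z^2"
    have w: "w \<noteq> 0" unfolding w_def using jac_third_neq_0 False assms p by metis
    have w2: "w^2 = 128 * z^4 - 2 * w * (1 - 5 * z^2)" using assms unfolding p jac_eq w_def by algebra
    have pt: "jac_point p = proj (wpt (64 * z^2) (64 * z) w)" "jac_point (jneg p) = proj (wpt (64 * z^2) (- (64 * z)) w)"
      using False jac_point_neq[of z y] jac_point_neq[of "- z" y] by (auto simp: p w_def jneg_def)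
    show ?thesis unfolding pt jac_point_zero
    proof (rule line_sectionI[of "64 * z^2" 0 0 1 w 0 w _ 1 "64 * z" _ 1 "- (64 * z)" _ 0 1])
      fix s t
      show "weier (s * (64 * z^2) + t * 0) (s * 0 + t * 1) (s * w + t * 0)
        = w * (s * (64 * z) - t * 1) * (s * - (64 * z) - t * 1) * (s * 1 - t * 0)"
        using w2 unfolding weier_def by algebra
    qed (use w in simp_all)
  qed
qed

text \<open>T is the affine origin, so all points on a line through it share the slope Y / X = 1 /
  z; the other intersection differs only in the sign of y.\<close>

lemma line_section_jac_T:
  assumes p: "(z, y) \<in> jac" "z \<noteq> 0"
  shows "line_section (jac_point (z, y)) (jac_point (z, - y)) (jac_point (0, - 1))"
proof -
  have pt: "jac_point (z, y) = proj (wpt (64 * z^2) (64 * z) (y - 1 + 5 * z^2))"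
    "jac_point (z, - y) = proj (wpt (64 * z^2) (64 * z) (- y - 1 + 5 * z^2))"
    "jac_point (0, - 1) = proj (wpt 0 0 1)"
    using p(2) jac_point_neq[of z] jac_point_neq[of 0 "- 1"] proj_scale[of "- 2" "wpt 0 0 1"]
    by (simp_all add: wpt_scale)
  show ?thesis unfolding pt
  proof (rule line_sectionI[of "64 * z^2" 0 "64 * z" 0 0 1 "2048 * z^2" _ 1 "y - 1 + 5 * z^2" _ 1 "- y - 1 + 5 * z^2" _ 0 1])
    fix s t
    show "weier (s * (64 * z^2) + t * 0) (s * (64 * z) + t * 0) (s * 0 + t * 1)
      = 2048 * z^2 * (s * (y - 1 + 5 * z^2) - t * 1) * (s * (- y - 1 + 5 * z^2) - t * 1) * (s * 1 - t * 0)"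
      using p(1) unfolding jac_eq weier_def by algebra
  qed (use p in simp_all)
qed

lemma line_section_jac_generic:
  assumes p: "(z1, y1) \<in> jac" "z1 \<noteq> 0" and q: "(z2, y2) \<in> jac" "z2 \<noteq> 0" and "z1 \<noteq> z2"
    and nz: "jadd_z z1 y1 z2 y2 \<noteq> 0"
  shows "line_section (jac_point (z1, y1)) (jac_point (z2, y2))
    (jac_point (jneg (jadd (z1, y1) (z2, y2))))"
proof -
  define c where "c = ((y1 - 1) / z1 - (y2 - 1) / z2) / (z1 - z2)"
  define b where "b = (y1 - 1) / z1 - c * z1"
  define L where "L = c^2 - 153"
  have L: "L \<noteq> 0" using sq_ne_153 by (simp add: L_def)
  have "b + c * z1 = (y1 - 1) / z1" by (simp add: b_def)
  then have y1: "y1 = 1 + b * z1 + c * z1^2" using p(2) by (simp add: field_simps power2_eq_square)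
  have "c * (z1 - z2) = (y1 - 1) / z1 - (y2 - 1) / z2" using assms(5) by (simp add: c_def)
  then have "b + c * z2 = (y2 - 1) / z2" by (simp add: b_def algebra_simps)
  then have y2: "y2 = 1 + b * z2 + c * z2^2" using q(2) by (simp add: field_simps power2_eq_square)
  have root: "L * z^3 + 2 * b * c * z^2 + (b^2 + 2 * c + 10) * z + 2 * b = 0"
    if "(z, 1 + b * z + c * z^2) \<in> jac" "z \<noteq> 0" for z
  proof -
    have "z * (L * z^3 + 2 * b * c * z^2 + (b^2 + 2 * c + 10) * z + 2 * b) = 0"
      using that(1) unfolding jac_eq L_def by algebra
    then show ?thesis using that(2) by simp
  qed
  note r1 = root[OF p(1)[unfolded y1] p(2)]
  note r2 = root[OF q(1)[unfolded y2] q(2)]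
  \<comment> \<open>The sum of the roots defines the third one; the other Vieta relations follow by
    subtracting the two root equations and dividing by z1 - z2.\<close>
  define z3 where "z3 = - 2 * b * c / L - z1 - z2"
  have v1: "L * (z1 + z2 + z3) = - 2 * b * c" using L by (simp add: z3_def)
  have "(z1 - z2) * (L * (z1 * z2 + z1 * z3 + z2 * z3) - (b^2 + 2 * c + 10)) = 0"
    using r1 r2 v1 by algebra
  then have v2: "L * (z1 * z2 + z1 * z3 + z2 * z3) = b^2 + 2 * c + 10" using assms(5) by simp
  have v3: "L * (z1 * z2 * z3) = - 2 * b" using r1 v1 v2 by algebra
  have sum: "jadd_z z1 y1 z2 y2 = - z3" "jadd_y z1 y1 z2 y2 = 1 + b * z3 + c * z3^2"
    using conic_vieta[OF v1[unfolded L_def] v2[unfolded L_def] v3[unfolded L_def] y1 y2] .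
  have z3: "z3 \<noteq> 0" using nz sum by simp
  have b0: "b \<noteq> 0" using v3 L z3 p(2) q(2) by auto
  \<comment> \<open>Dividing the coordinates by z makes them linear in z, so the conic becomes a
    line with parameter (z : 1).\<close>
  have pt: "jac_point (z, 1 + b * z + c * z^2) = proj (wpt (64 * z) 64 (b + (c + 5) * z))" if "z \<noteq> 0" for z
  proof -
    have "jac_point (z, 1 + b * z + c * z^2) = proj (z *s wpt (64 * z) 64 (b + (c + 5) * z))"
      unfolding wpt_scale using that by (simp add: jac_point_neq power2_eq_square algebra_simps)
    then show ?thesis using proj_scale that by simp
  qed
  have third: "jneg (jadd (z1, y1) (z2, y2)) = (z3, 1 + b * z3 + c * z3^2)"
    by (simp add: jneg_def jadd_def sum)
  show ?thesis unfolding third unfolding y1 y2 pt[OF p(2)] pt[OF q(2)] pt[OF z3]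
  proof (rule line_sectionI[of 64 0 0 64 "c + 5" b "2048 * L" _ z1 1 _ z2 1 _ z3 1])
    fix s t
    have "weier (s * 64 + t * 0) (s * 0 + t * 64) (s * (c + 5) + t * b)
      = 2048 * (L * s^3 + 2 * b * c * s^2 * t + (b^2 + 2 * c + 10) * s * t^2 + 2 * b * t^3)"
      unfolding weier_def L_def by algebra
    also have "\<dots> = 2048 * L * (s * 1 - t * z1) * (s * 1 - t * z2) * (s * 1 - t * z3)"
      using v1 v2 v3 by algebra
    finally show "weier (s * 64 + t * 0) (s * 0 + t * 64) (s * (c + 5) + t * b)
      = 2048 * L * (s * 1 - t * z1) * (s * 1 - t * z2) * (s * 1 - t * z3)" .
  qed (use L b0 in \<open>simp_all add: algebra_simps\<close>)
qed

lemma jneg_jneg [simp]: "jneg (jneg p) = p"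
  by (simp add: jneg_def)

lemma jneg_jadd: "jneg (jadd p q) = jadd (jneg p) (jneg q)"
proof -
  have "- (fst p * snd q + snd p * fst q) = - fst p * snd q + snd p * - fst q" by simp
  then show ?thesis
    unfolding jneg_def jadd_def jadd_z_def jadd_y_def fst_conv snd_conv minus_divide_left by simp
qed

lemma jac_z_eq_0: "(0, y) \<in> jac \<Longrightarrow> y = 1 \<or> y = - 1"
  by (simp add: jac_eq power2_eq_1_iff)

text \<open>The first coordinates alone turn 2 P = -P into 2 y = 153 z^4 - 1; rewritten for the
  Weierstrass coordinate X, this is again a root of the 3-division polynomial.\<close>

lemma jac_no_three_torsion:
  assumes "p \<in> jac" "jadd p p = jneg p"
  shows "p = (0, 1)"
proof (rule ccontr)
  assume ne: "p \<noteq> (0, 1)"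
  obtain z y where p: "p = (z, y)" by (cases p)
  have y2: "y^2 = 153 * z^4 - 10 * z^2 + 1" using assms(1) unfolding p jac_eq .
  have z: "z \<noteq> 0"
  proof
    assume "z = 0"
    then have "p = (0, - 1)" using jac_z_eq_0 assms(1) ne p by blast
    then show False using assms(2) by (simp add: jadd_T jneg_def)
  qed
  have "2 * z * y / (1 - 153 * z^2 * z^2) = - z"
    using assms(2) by (simp add: p jneg_def jadd_def jadd_z_def mult_ac)
  then have "2 * z * y = - z * (1 - 153 * z^2 * z^2)" using jadd_denominator[of z z] by (simp add: divide_eq_eq)
  then have "z * (2 * y) = z * (153 * z^4 - 1)" by algebra
  then have y: "2 * y = 153 * z^4 - 1" using z by simp
  define X where "X = (1 + y - 5 * z^2) / (2 * z^2)"
  have X: "X * (2 * z^2) = 1 + y - 5 * z^2" using z by (simp add: X_def)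
  have "z^8 * (3 * X^4 + 20 * X^3 - 192 * X^2 - 1024) = 0" using X y y2 by algebra
  then show False using z three_division_no_root by simp
qed

lemma line_section_jac_distinct:
  assumes p: "p \<in> jac" "p \<notin> {(0, 1), (0, - 1)}" and q: "q \<in> jac" "q \<notin> {(0, 1), (0, - 1)}"
    and "p \<noteq> q" and s: "jadd p q \<notin> {(0, 1), (0, - 1)}"
  shows "line_section (jac_point p) (jac_point q) (jac_point (jneg (jadd p q)))"
proof -
  obtain z1 y1 z2 y2 where pq: "p = (z1, y1)" "q = (z2, y2)" by (cases p, cases q)
  have z: "z1 \<noteq> 0" "z2 \<noteq> 0" using p q jac_z_eq_0 unfolding pq by auto
  have nz: "jadd_z z1 y1 z2 y2 \<noteq> 0"
    using jadd_closed[OF p(1) q(1)] s jac_z_eq_0[of "jadd_y z1 y1 z2 y2"] unfolding pq jadd_def by auto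
  have "z1 \<noteq> z2"
  proof
    assume eq: "z1 = z2"
    then have "y1^2 = y2^2" using p q unfolding pq jac_eq by simp
    then have "y1 = - y2" using assms(5) eq pq power2_eq_iff by blast
    then show False using nz eq by (simp add: jadd_z_def)
  qed
  then show ?thesis
    using line_section_jac_generic p q z nz unfolding pq by blast
qed

lemma line_section_jac_sum_T:
  assumes "p \<in> jac" "p \<notin> {(0, 1), (0, - 1)}"
  shows "line_section (jac_point (0, - 1)) (jac_point p) (jac_point (jneg (jadd (0, - 1) p)))"
proof -
  obtain z y where p: "p = (z, y)" by (cases p)
  have "z \<noteq> 0" using assms jac_z_eq_0 unfolding p by auto
  then have "line_section (jac_point (z, y)) (jac_point (z, - y)) (jac_point (0, - 1))"
    using line_section_jac_T assms p by blast
  from line_section_swap12[OF line_section_swap23[OF this]]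
  have "line_section (jac_point (0, - 1)) (jac_point p) (jac_point (z, - y))" unfolding p .
  moreover have "jneg (jadd (0, - 1) p) = (z, - y)" by (simp add: p jadd_T jneg_def)
  ultimately show ?thesis by simp
qed

(* The tangent at p is reduced to the chord through p and - 2 p, which differ because there is no
   rational 3-torsion. *)
lemma line_section_jac:
  assumes p: "p \<in> jac" and q: "q \<in> jac"
  shows "line_section (jac_point p) (jac_point q) (jac_point (jneg (jadd p q)))"
proof -
  note perm = line_section_swap12 line_section_swap23
  have T: "(0, - 1) \<in> jac" "jneg (0, - 1) = (0, - 1)" by (simp_all add: jac_eq jneg_def)
  have O: "jneg (0, 1) = (0, 1)" by (simp add: jneg_def)
  have inverse: "jadd p' q' = r \<Longrightarrow> q' = jadd (jneg p') r" if "p' \<in> jac" "q' \<in> jac" for p' q' r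
    using jadd_assoc[OF jneg_closed[OF that(1)] that] jadd_jneg[OF that(1)] by auto
  \<comment> \<open>The line passes through O in the first three cases, through T in the next three,
    and through neither in the last.\<close>
  consider "p = (0, 1)" | "q = (0, 1)" | "jadd p q = (0, 1)"
    | "p = (0, - 1)" "q \<notin> {(0, 1), (0, - 1)}" | "q = (0, - 1)" "p \<notin> {(0, 1), (0, - 1)}"
    | "jadd p q = (0, - 1)" "p \<notin> {(0, 1), (0, - 1)}"
    | "p \<notin> {(0, 1), (0, - 1)}" "q \<notin> {(0, 1), (0, - 1)}" "jadd p q \<notin> {(0, 1), (0, - 1)}"
    using jadd_T[of "(0, - 1)"] by fastforce
  then show ?thesis
  proof cases
    case 1
    then show ?thesis using perm line_section_jac_neg[OF q] by (metis jadd_zero(1))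
  next
    case 2
    then show ?thesis using perm line_section_jac_neg[OF p] by (metis jadd_zero(2))
  next
    case 3
    then have "q = jneg p" using inverse[OF p q] by simp
    then show ?thesis using line_section_jac_neg[OF p] 3 O by simp
  next
    case 4
    then show ?thesis using line_section_jac_sum_T[OF q] by simp
  next
    case 5
    then show ?thesis using line_section_jac_sum_T[OF p] perm(1) by (metis jadd_commute)
  next
    case 6
    then have "q = jadd (0, - 1) (jneg p)" using inverse[OF p q] jadd_commute by metis
    then have "q = jneg (jadd (0, - 1) p)" by (simp add: jadd_T jneg_def)
    then show ?thesis using line_section_jac_sum_T[OF p 6(2)] perm 6(1) T(2) by metis
  next
    case 7
    show ?thesis
    proof (cases "p = q")
      case False
      then show ?thesis using line_section_jac_distinct 7 p q by blast
    next
      case True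
      define r where "r = jneg (jadd p p)"
      have r: "r \<in> jac" unfolding r_def using p by (intro jneg_closed jadd_closed)
      have "p \<noteq> r"
        using jac_no_three_torsion[OF p] 7(1) unfolding r_def by (metis insertI1 jneg_jneg)
      moreover have r': "r \<notin> {(0, 1), (0, - 1)}"
        using 7(3) True O T(2) unfolding r_def by (metis insert_iff jneg_jneg singletonD)
      moreover have pr: "jadd p r = jneg p"
      proof -
        have "jadd (jneg (jadd p p)) p = jneg p"
          using jadd_assoc[OF jneg_closed[OF p] jneg_closed[OF p] p] jadd_jneg[OF p] by (simp add: jneg_jadd)
        then show ?thesis by (simp add: r_def jadd_commute)
      qed
      moreover have "jneg p \<notin> {(0, 1), (0, - 1)}"
        using 7(1) O T(2) by (metis insert_iff jneg_jneg singletonD)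
      ultimately have "line_section (jac_point p) (jac_point r) (jac_point (jneg (jadd p r)))"
        using line_section_jac_distinct[OF p 7(1) r] by simp
      then show ?thesis using perm(2) True pr by (simp add: r_def)
    qed
  qed
qed

text \<open>\<open>line_section_unique\<close> needs two distinct points. A tangent is permuted
  until its two distinct points come first, and a triple point off O is excluded by
  \<open>line_section_flex\<close>.\<close>

lemma line_section_jac_imp:
  assumes p: "p \<in> jac" and q: "q \<in> jac" and r: "r \<in> jac"
    and ls: "line_section (jac_point p) (jac_point q) (jac_point r)"
  shows "r = jneg (jadd p q)"
proof -
  have distinct: "r = jneg (jadd p q)" if pqr: "p \<in> jac" "q \<in> jac" "r \<in> jac" "p \<noteq> q"
    "line_section (jac_point p) (jac_point q) (jac_point r)" for p q r
  proof -
    obtain v1 where v1: "jac_point p = proj v1" "v1 \<noteq> 0" using jac_point_rep[OF pqr(1)] .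
    obtain v2 where v2: "jac_point q = proj v2" "v2 \<noteq> 0" using jac_point_rep[OF pqr(2)] .
    have "jac_point p \<noteq> jac_point q" using jac_point_inj pqr by blast
    then have "jac_point r = jac_point (jneg (jadd p q))"
      using line_section_unique[of v1 v2] line_section_jac[OF pqr(1,2)] pqr(5) v1 v2 by simp
    then show ?thesis using jac_point_inj pqr jneg_closed jadd_closed by blast
  qed
  consider "p \<noteq> q" | "p = q" "p \<noteq> r" | "p = q" "p = r" by blast
  then show ?thesis
  proof cases
    case 1
    then show ?thesis using distinct p q r ls by blast
  next
    case 2
    then have "p = jneg (jadd p r)" using distinct[OF p r p] ls line_section_swap23 by blast
    then have "jneg p = jadd p r" by (metis jneg_jneg)
    then have "jadd (jneg p) (jneg p) = jadd (jneg p) (jadd p r)" by simp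
    also have "\<dots> = r" using jadd_assoc[OF jneg_closed[OF p] p r] jadd_jneg[OF p] by simp
    also have "jadd (jneg p) (jneg p) = jneg (jadd p p)" by (simp add: jneg_jadd)
    finally show ?thesis using 2 by simp
  next
    case 3
    have "p = (0, 1)"
    proof (rule ccontr)
      assume ne: "p \<noteq> (0, 1)"
      obtain z y where zy: "p = (z, y)" by (cases p)
      define w where "w = y - 1 + 5 * z^2"
      have w: "w \<noteq> 0" unfolding w_def using jac_third_neq_0 ne p zy by metis
      have "jac_point p = proj (wpt (64 * z^2) (64 * z) w)"
        using jac_point_neq ne unfolding zy w_def by blast
      also have "wpt (64 * z^2) (64 * z) w = w *s wpt (64 * z^2 / w) (64 * z / w) 1"
        using w by (simp add: wpt_scale)
      also have "proj \<dots> = proj (wpt (64 * z^2 / w) (64 * z / w) 1)" using w by (rule proj_scale)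
      finally show False using line_section_flex ls 3 by metis
    qed
    then show ?thesis using 3 by (simp add: jneg_def)
  qed
qed

section \<open>Transport of the group structure and the rank\<close>

lemma third_point_jac:
  assumes "p \<in> jac" "q \<in> jac"
  shows "third_point (jac_point p) (jac_point q) = jac_point (jneg (jadd p q))"
  unfolding third_point_def
proof (rule the_equality)
  show "jac_point (jneg (jadd p q)) \<in> curve_points
      \<and> line_section (jac_point p) (jac_point q) (jac_point (jneg (jadd p q)))"
    using jac_point_closed[OF jneg_closed[OF jadd_closed[OF assms]]] line_section_jac[OF assms] by simp
next
  fix R assume R: "R \<in> curve_points \<and> line_section (jac_point p) (jac_point q) R"
  then obtain r where "r \<in> jac" "R = jac_point r" using jac_point_surj by blast
  then show "R = jac_point (jneg (jadd p q))" using line_section_jac_imp assms R by blast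
qed

lemma jac_point_iso: "jac_point \<in> iso jac_group curve_group"
proof (rule isoI)
  show "jac_point \<in> hom jac_group curve_group"
  proof (rule homI)
    fix p q assume "p \<in> carrier jac_group" "q \<in> carrier jac_group"
    then have pq: "p \<in> jac" "q \<in> jac" by simp_all
    have "curve_O = jac_point (0, 1)" by (simp add: curve_O_wpt jac_point_zero)
    then have "third_point curve_O (third_point (jac_point p) (jac_point q)) = jac_point (jadd p q)"
      using third_point_jac pq jneg_closed jadd_closed third_point_jac[of "(0, 1)" "jneg (jadd p q)"]
      by (simp add: jac_eq)
    then show "jac_point (p \<otimes>\<^bsub>jac_group\<^esub> q) = jac_point p \<otimes>\<^bsub>curve_group\<^esub> jac_point q"
      by (simp add: curve_group_def)
  qed (simp add: curve_group_def jac_point_closed)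
  show "bij_betw jac_point (carrier jac_group) (carrier curve_group)"
    unfolding bij_betw_def inj_on_def curve_group_def
    using jac_point_inj jac_point_closed jac_point_surj by (auto simp: image_iff)
qed

lemma comm_group_curve_group: "comm_group curve_group"
proof -
  \<comment> \<open>The image of a group under an isomorphism carries the image of the unit as its
    \<open>one\<close>; here that is already \<open>curve_O\<close>.\<close>
  have "curve_group\<lparr>one := jac_point \<one>\<^bsub>jac_group\<^esub>\<rparr> = curve_group"
    by (simp add: curve_group_def curve_O_wpt jac_point_zero)
  then show ?thesis
    using comm_group.iso_imp_img_comm_group[OF comm_group_jac_group jac_point_iso] by simp
qed

theorem theorem4p10:
  shows "abelian_rank curve_group = 1"
proof -
  interpret J: comm_group jac_group by (rule comm_group_jac_group)
  interpret C: comm_group curve_group by (rule comm_group_curve_group)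
  have hom: "jac_point \<in> hom jac_group curve_group"
    using jac_point_iso by (simp add: iso_def)
  have carrier: "carrier curve_group = curve_points"
    and one: "\<one>\<^bsub>curve_group\<^esub> = jac_point (0, 1)"
    by (simp_all add: curve_group_def curve_O_wpt jac_point_zero)
  have pow: "jac_point (p [^]\<^bsub>jac_group\<^esub> n) = jac_point p [^]\<^bsub>curve_group\<^esub> n"
    if "p \<in> jac" for p and n :: int
    using hom_int_pow[OF hom _ J.is_group C.is_group] that by simp
  have O: "(0, 1) \<in> jac" and g: "(1 / 3, 4 / 3) \<in> jac" by (simp_all add: jac_eq power_divide)
  define q :: "rat \<times> rat" where "q = (44 / 127, 22833 / 16129)"
  have q: "q \<in> jac" "val2 (Suc 1) (fst q)"
    using jac_witness by (simp_all add: q_def numeral_2_eq_2)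
  show ?thesis
  proof (rule C.abelian_rank_eq_1[of "jac_point q" "jac_point (1 / 3, 4 / 3)"])
    show "jac_point q \<in> carrier curve_group" "jac_point (1 / 3, 4 / 3) \<in> carrier curve_group"
      using q g jac_point_closed carrier by auto
  next
    fix n :: int
    assume "jac_point q [^]\<^bsub>curve_group\<^esub> n = \<one>\<^bsub>curve_group\<^esub>"
    then have "jac_point (q [^]\<^bsub>jac_group\<^esub> n) = jac_point (0, 1)" using pow[OF q(1)] one by simp
    then have "q [^]\<^bsub>jac_group\<^esub> n = (0, 1)"
      using jac_point_inj O J.int_pow_closed q(1) by simp
    then show "n = 0" using jac_infinite_order q by blast
  next
    fix P assume "P \<in> carrier curve_group"
    then obtain p where p: "p \<in> jac" "P = jac_point p" using jac_point_surj[of P] carrier by auto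
    obtain N m :: int where "N \<noteq> 0" "p [^]\<^bsub>jac_group\<^esub> N = (1 / 3, 4 / 3) [^]\<^bsub>jac_group\<^esub> m"
      using jac_commensurable[OF p(1)] by blast
    then show "\<exists>(N::int) m::int. N \<noteq> 0 \<and>
        P [^]\<^bsub>curve_group\<^esub> N = jac_point (1 / 3, 4 / 3) [^]\<^bsub>curve_group\<^esub> m"
      using pow[OF p(1)] pow[OF g] p(2) by metis
  qed
qed

end
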